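(* Let $X$ be a topological space, $a,b\in X$ and $n\geq 1$. For a path $\tilde\gamma\in\mathrm{Chem}(a,b)$ let $[\tilde\gamma^{(n)}]\in \mathrm H_n(X^n,Y^{(n)}_{ab})$ be the relative homology class of the singular simplex $\tilde\gamma^{(n)}$. (a) There is a unique map $F_n:\pi_1(a,b)\to \mathrm H_n(X^n,Y^{(n)}_{ab})$ such that $[\tilde\gamma^{(n)}]=F_n([\tilde\gamma])$ for every $\tilde\gamma\in\mathrm{Chem}(a,b)$, where $[\tilde\gamma]\in\pi_1(a,b)$ is the homotopy class of $\tilde\gamma$. (b) For every $\gamma\in\pi_1(a,b)$ and all $\alpha_0,\ldots,\alpha_n\in\pi_1(a)$, one has $$\sum_{I\subset\{0,1,\ldots,n\}}(-1)^{|I|}F_n\Big(\gamma\cdot\prod_{i\in I}\alpha_i\Big)=0$$ in $\mathrm H_n(X^n,Y^{(n)}_{ab})$, where $\prod_{i\in I}\alpha_i:=\alpha_{i(1)}\cdots\alpha_{i(|I|)}$ with $i:\{1,\ldots,|I|\}\to I$ the unique increasing bijection. Consequently the $\mathbb Z$-linear extension of $F_n$ factors through a linear map $$\overline F^{(n)}_{ab}:\ \mathbb Z\pi_1(a,b)\big/\big(\mathbb Z\pi_1(a,b)\cdot(\mathbb Z\pi_1(a))_+^{n+1}\big)\to \mathrm H_n(X^n,Y^{(n)}_{ab}),$$ where $(\mathbb Z\pi_1(a))_+$ is the augmentation ideal of the group ring $\mathbb Z\pi_1(a)$.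
   Context: $\Delta^n:=\{(t_1,\ldots,t_n)\in\mathbb R^n\mid 0\leq t_1\leq\cdots\leq t_n\leq 1\}$. For a space $Z$, $C_n(Z)$ is the free abelian group on continuous maps $\Delta^n\to Z$, with singular differential $c\mapsto\sum_{i=0}^n(-1)^i c\circ\partial_i^n$, where $\partial_i^n:\Delta^{n-1}\to\Delta^n$, $(t_1,\ldots,t_{n-1})\mapsto(t_1,\ldots,t_i,t_i,\ldots,t_{n-1})$ with the convention $t_0=0$, $t_n=1$ (so $\partial^n_0$ inserts $0$ in first position and $\partial_n^n$ inserts $1$ in last position). $\mathrm H_\bullet(Z,W)$ is the homology of $C_\bullet(Z)/C_\bullet(W)$ (coefficients $\mathbb Z$), for $W\subset Z$ with the subspace topology. $\mathrm{Chem}(a,b)$ is the set of continuous maps $\tilde\gamma:[0,1]\to X$ with $\tilde\gamma(0)=a$, $\tilde\gamma(1)=b$; $\pi_1(a,b)$ is its quotient by homotopy with fixed endpoints; $\pi_1(a):=\pi_1(a,a)$. The product $\gamma\cdot\alpha$ of $\gamma\in\pi_1(a,b)$ and $\alpha\in\pi_1(a)$ is the class of the path running first along $\alpha$, then along $\gamma$; similarly for products in $\pi_1(a)$. Thus $\mathbb Z\pi_1(a,b)$ is a right $\mathbb Z\pi_1(a)$-module. $Y^{(n)}_{ab}:=\bigcup_{i=0}^n\{(x_1,\ldots,x_n)\in X^n\mid x_i=x_{i+1}\}$ with the convention $x_0=a$, $x_{n+1}=b$. $\tilde\gamma^{(n)}:\Delta^n\to X^n$ is the map $(t_1,\ldots,t_n)\mapsto(\tilde\gamma(t_1),\ldots,\tilde\gamma(t_n))$;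 its boundary lies in $C_{n-1}(Y^{(n)}_{ab})$, so it defines a class $[\tilde\gamma^{(n)}]\in\mathrm H_n(X^n,Y^{(n)}_{ab})$. *)

theory Defs
  imports "HOL-Homology.Homology" "HOL-Algebra.Ideal_Product"
begin

section \<open>Paths up to homotopy with fixed endpoints\<close>

text \<open>
  Spaces are values of type \<^typ>\<open>'a topology\<close>, so the library notions for type-class topologies
  (\<^const>\<open>joinpaths\<close>, \<^const>\<open>homotopic_paths\<close>) do not apply; the definitions below are
  their analogues. A path is a function on \<^typ>\<open>real\<close> of which only the restriction to
  \<open>{0..1}\<close> matters: \<^const>\<open>homotopic_with\<close> identifies functions that agree on the
  topspace of its domain.
\<close>

definition Chem :: "'a topology \<Rightarrow> 'a \<Rightarrow> 'a \<Rightarrow> (real \<Rightarrow> 'a) set" where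
  "Chem X a b = {g. pathin X g \<and> g 0 = a \<and> g 1 = b}"

definition path_homotopic :: "'a topology \<Rightarrow> (real \<Rightarrow> 'a) \<Rightarrow> (real \<Rightarrow> 'a) \<Rightarrow> bool" where
  "path_homotopic X p q \<longleftrightarrow>
     homotopic_with (\<lambda>r. r 0 = p 0 \<and> r 1 = p 1) (top_of_set {0..1}) X p q"

definition path_class :: "'a topology \<Rightarrow> (real \<Rightarrow> 'a) \<Rightarrow> (real \<Rightarrow> 'a) set" where
  "path_class X p = {q. path_homotopic X p q}"

definition pi1 :: "'a topology \<Rightarrow> 'a \<Rightarrow> 'a \<Rightarrow> (real \<Rightarrow> 'a) set set" where
  "pi1 X a b = path_class X ` Chem X a b"

text \<open>\<open>then_path p q\<close> runs first along \<open>p\<close>, then along \<open>q\<close>.\<close>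

definition then_path :: "(real \<Rightarrow> 'a) \<Rightarrow> (real \<Rightarrow> 'a) \<Rightarrow> real \<Rightarrow> 'a" where
  "then_path p q = (\<lambda>t. if t \<le> 1/2 then p (2 * t) else q (2 * t - 1))"

text \<open>The product \<open>C \<cdot> A\<close> runs first along \<open>A\<close>, then along \<open>C\<close>.\<close>

definition class_mult ::
  "'a topology \<Rightarrow> (real \<Rightarrow> 'a) set \<Rightarrow> (real \<Rightarrow> 'a) set \<Rightarrow> (real \<Rightarrow> 'a) set" where
  "class_mult X C A = {r. \<exists>g\<in>C. \<exists>h\<in>A. path_homotopic X (then_path h g) r}"

definition pi1_group :: "'a topology \<Rightarrow> 'a \<Rightarrow> (real \<Rightarrow> 'a) set monoid" where
  "pi1_group X a = \<lparr>carrier = pi1 X a a, monoid.mult = class_mult X, one = path_class X (\<lambda>_. a)\<rparr>"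

text \<open>For a finite set of indices: the product of the \<open>\<alpha> i\<close>, with \<open>i\<close> increasing from left to right.\<close>

definition ordered_prod :: "('g, 'm) monoid_scheme \<Rightarrow> (nat \<Rightarrow> 'g) \<Rightarrow> nat set \<Rightarrow> 'g" where
  "ordered_prod G \<alpha> I = foldr (mult G) (map \<alpha> (sorted_list_of_set I)) \<one>\<^bsub>G\<^esub>"


section \<open>Group rings over the integers and the quotient module\<close>

text \<open>The bilinear extension of an operation on basis elements.\<close>

definition frag_bilinear ::
  "('a \<Rightarrow> 'b \<Rightarrow> 'c) \<Rightarrow> ('a \<Rightarrow>\<^sub>0 int) \<Rightarrow> ('b \<Rightarrow>\<^sub>0 int) \<Rightarrow> ('c \<Rightarrow>\<^sub>0 int)" where
  "frag_bilinear m c d = frag_extend (\<lambda>x. frag_extend (\<lambda>y. frag_of (m x y)) d) c"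

definition int_group_ring :: "('g, 'm) monoid_scheme \<Rightarrow> ('g \<Rightarrow>\<^sub>0 int) ring" where
  "int_group_ring G =
     \<lparr>carrier = carrier (free_Abelian_group (carrier G)),
      monoid.mult = frag_bilinear (mult G), one = frag_of \<one>\<^bsub>G\<^esub>, zero = 0, add = (+)\<rparr>"

definition augmentation :: "('g \<Rightarrow>\<^sub>0 int) \<Rightarrow> int" where
  "augmentation c = (\<Sum>x\<in>Poly_Mapping.keys c. Poly_Mapping.lookup c x)"

definition augmentation_ideal :: "('g, 'm) monoid_scheme \<Rightarrow> ('g \<Rightarrow>\<^sub>0 int) set" where
  "augmentation_ideal G = {c \<in> carrier (int_group_ring G). augmentation c = 0}"

primrec ideal_power :: "('r, 'm) ring_scheme \<Rightarrow> 'r set \<Rightarrow> nat \<Rightarrow> 'r set" where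
  "ideal_power R I 0 = carrier R"
| "ideal_power R I (Suc k) = ideal_prod R (ideal_power R I k) I"

abbreviation Zpi1 :: "'a topology \<Rightarrow> 'a \<Rightarrow> 'a \<Rightarrow> ((real \<Rightarrow> 'a) set \<Rightarrow>\<^sub>0 int) monoid" where
  "Zpi1 X a b \<equiv> free_Abelian_group (pi1 X a b)"

text \<open>
  The submodule \<open>\<int>\<pi>\<^sub>1(a,b) \<cdot> (\<int>\<pi>\<^sub>1(a))\<^sub>+\<^sup>k\<close>, the additive subgroup generated by the products.
\<close>

definition Zpi1_aug_submodule ::
  "'a topology \<Rightarrow> 'a \<Rightarrow> 'a \<Rightarrow> nat \<Rightarrow> ((real \<Rightarrow> 'a) set \<Rightarrow>\<^sub>0 int) set" where
  "Zpi1_aug_submodule X a b k =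
     generate (Zpi1 X a b)
       {frag_bilinear (class_mult X) c u | c u.
          c \<in> carrier (Zpi1 X a b) \<and>
          u \<in> ideal_power (int_group_ring (pi1_group X a)) (augmentation_ideal (pi1_group X a)) k}"

text \<open>The \<open>\<int>\<close>-linear extension of a map into an abelian group written multiplicatively.\<close>

definition int_linear_extension ::
  "('h, 'm) monoid_scheme \<Rightarrow> ('g \<Rightarrow> 'h) \<Rightarrow> ('g \<Rightarrow>\<^sub>0 int) \<Rightarrow> 'h" where
  "int_linear_extension H F c =
     finprod H (\<lambda>x. F x [^]\<^bsub>H\<^esub> Poly_Mapping.lookup c x) (Poly_Mapping.keys c)"


section \<open>The pair of spaces and the simplex of a path\<close>

definition with_ends :: "nat \<Rightarrow> 'a \<Rightarrow> 'a \<Rightarrow> (nat \<Rightarrow> 'a) \<Rightarrow> nat \<Rightarrow> 'a" where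
  "with_ends n lo hi x i = (if i = 0 then lo else if i = n + 1 then hi else x i)"

abbreviation power_space :: "'a topology \<Rightarrow> nat \<Rightarrow> (nat \<Rightarrow> 'a) topology" where
  "power_space X n \<equiv> product_topology (\<lambda>_. X) {1..n}"

definition Yset :: "'a topology \<Rightarrow> 'a \<Rightarrow> 'a \<Rightarrow> nat \<Rightarrow> (nat \<Rightarrow> 'a) set" where
  "Yset X a b n =
     (\<Union>i\<in>{0..n}. {x \<in> topspace (power_space X n). with_ends n a b x i = with_ends n a b x (i + 1)})"

text \<open>
  The simplex \<open>0 \<le> t\<^sub>1 \<le> \<dots> \<le> t\<^sub>n \<le> 1\<close>. The homology library uses barycentric coordinates
  \<open>(x\<^sub>0, \<dots>, x\<^sub>n)\<close> instead; the two are identified by \<open>t\<^sub>i = x\<^sub>0 + \<dots> + x\<^bsub>i-1\<^esub>\<close>. As shown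
  below this is a homeomorphism, and it carries the \<open>i\<close>-th face inclusion of the library to the map
  \<open>(t\<^sub>1, \<dots>, t\<^bsub>n-1\<^esub>) \<mapsto> (t\<^sub>1, \<dots>, t\<^sub>i, t\<^sub>i, \<dots>, t\<^bsub>n-1\<^esub>)\<close>, where \<open>t\<^sub>0 = 0\<close> and \<open>t\<^sub>n = 1\<close>. The two
  singular chain complexes are therefore the same, and so is relative homology.
\<close>

definition ordered_simplex :: "nat \<Rightarrow> (nat \<Rightarrow> real) set" where
  "ordered_simplex n =
     {t \<in> extensional {1..n}. \<forall>i\<in>{0..n}. with_ends n 0 1 t i \<le> with_ends n 0 1 t (i + 1)}"

definition ordered_coords :: "nat \<Rightarrow> (nat \<Rightarrow> real) \<Rightarrow> nat \<Rightarrow> real" where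
  "ordered_coords n x = (\<lambda>i\<in>{1..n}. \<Sum>j<i. x j)"

definition barycentric_coords :: "nat \<Rightarrow> (nat \<Rightarrow> real) \<Rightarrow> nat \<Rightarrow> real" where
  "barycentric_coords n t =
     (\<lambda>i. if i \<le> n then with_ends n 0 1 t (i + 1) - with_ends n 0 1 t i else 0)"

definition ordered_face :: "nat \<Rightarrow> nat \<Rightarrow> (nat \<Rightarrow> real) \<Rightarrow> nat \<Rightarrow> real" where
  "ordered_face n i t =
     (\<lambda>j\<in>{1..n}. with_ends (n - 1) 0 1 t (if j \<le> i then j else j - 1))"

lemma with_ends_ordered_coords:
  assumes "x \<in> standard_simplex n" "i \<le> n + 1"
  shows "with_ends n 0 1 (ordered_coords n x) i = (\<Sum>j<i. x j)"
  using assms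
  by (auto simp: with_ends_def ordered_coords_def standard_simplex_def lessThan_Suc_atMost)

lemma ordered_coords_face:
  assumes "n \<ge> 1" "i \<le> n" "x \<in> standard_simplex (n - 1)"
  shows "ordered_coords n (simplical_face i x) = ordered_face n i (ordered_coords (n - 1) x)"
proof
  fix j
  have low: "(\<Sum>l<j. simplical_face i x l) = (\<Sum>l<j. x l)" if "j \<le> i" for j
    using that by (intro sum.cong) (auto simp: simplical_face_def)
  have high: "(\<Sum>l<Suc j. simplical_face i x l) = (\<Sum>l<j. x l)" if "i \<le> j" for j
    using that
  proof (induction j rule: dec_induct)
    case base
    then show ?case using low[of i] by (simp add: simplical_face_def)
  next
    case (step m)
    then show ?case by (simp add: simplical_face_def)
  qed
  show "ordered_coords n (simplical_face i x) j = ordered_face n i (ordered_coords (n - 1) x) j"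
  proof (cases "j \<in> {1..n}")
    case True
    then show ?thesis
      using low[of j] high[of "j - 1"] assms
      by (auto simp: ordered_face_def with_ends_ordered_coords ordered_coords_def[of n])
  qed (auto simp: ordered_coords_def ordered_face_def)
qed

lemma ordered_coords_in_ordered_simplex:
  assumes "x \<in> standard_simplex n"
  shows "ordered_coords n x \<in> ordered_simplex n"
  using assms by (auto simp: ordered_simplex_def with_ends_ordered_coords)
    (auto simp: ordered_coords_def standard_simplex_def)

lemma sum_barycentric_coords:
  assumes "i \<le> n + 1"
  shows "(\<Sum>j<i. barycentric_coords n t j) = with_ends n 0 1 t i"
  using assms by (induction i) (auto simp: barycentric_coords_def with_ends_def)

lemma barycentric_coords_in_standard_simplex:
  assumes "t \<in> ordered_simplex n"
  shows "barycentric_coords n t \<in> standard_simplex n"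
proof -
  have nonneg: "0 \<le> barycentric_coords n t i" for i
    using assms by (auto simp: barycentric_coords_def ordered_simplex_def)
  have sum1: "(\<Sum>i\<le>n. barycentric_coords n t i) = 1"
    using sum_barycentric_coords[of "Suc n" n t]
    by (simp add: lessThan_Suc_atMost with_ends_def)
  have "barycentric_coords n t i \<le> 1" for i
  proof (cases "i \<le> n")
    case True
    then show ?thesis
      using member_le_sum[of i "{..n}" "barycentric_coords n t"] nonneg sum1 by auto
  qed (simp add: barycentric_coords_def)
  with nonneg sum1 show ?thesis
    by (auto simp: standard_simplex_def barycentric_coords_def)
qed

lemma ordered_coords_homeomorphic_maps:
  "homeomorphic_maps
     (subtopology (powertop_real UNIV) (standard_simplex n))
     (subtopology (power_space euclideanreal n) (ordered_simplex n))
     (ordered_coords n) (barycentric_coords n)"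
proof -
  have c1: "continuous_map (powertop_real UNIV) (power_space euclideanreal n) (ordered_coords n)"
    unfolding ordered_coords_def continuous_map_componentwise
    by (auto intro!: continuous_map_sum continuous_map_product_projection)
  have pr: "continuous_map (power_space euclideanreal n) euclideanreal (\<lambda>t. with_ends n 0 1 t i)"
    if "i \<le> n + 1" for i
    using that unfolding with_ends_def
    by (cases "i = 0"; cases "i = n + 1") (auto intro!: continuous_map_product_projection)
  have c2: "continuous_map (power_space euclideanreal n) (powertop_real UNIV) (barycentric_coords n)"
    unfolding continuous_map_componentwise_UNIV
  proof
    fix i
    show "continuous_map (power_space euclideanreal n) euclideanreal (\<lambda>t. barycentric_coords n t i)"
      using pr[of i] pr[of "i + 1"]
      by (cases "i \<le> n") (auto simp: barycentric_coords_def intro!: continuous_map_diff)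
  qed
  have e1: "barycentric_coords n (ordered_coords n x) = x" if "x \<in> standard_simplex n" for x
  proof
    fix i
    show "barycentric_coords n (ordered_coords n x) i = x i"
      using that
      by (auto simp: barycentric_coords_def with_ends_ordered_coords[OF that])
         (auto simp: standard_simplex_def)
  qed
  have e2: "ordered_coords n (barycentric_coords n t) = t" if "t \<in> ordered_simplex n" for t
    using that
    by (auto simp: ordered_coords_def ordered_simplex_def sum_barycentric_coords with_ends_def
        extensional_def fun_eq_iff)
  show ?thesis
    unfolding homeomorphic_maps_def
    using c1 c2 e1 e2
    by (auto simp: continuous_map_in_subtopology continuous_map_from_subtopology
        ordered_coords_in_ordered_simplex barycentric_coords_in_standard_simplex)
qed

definition path_simplex :: "nat \<Rightarrow> (real \<Rightarrow> 'a) \<Rightarrow> (nat \<Rightarrow> real) \<Rightarrow> nat \<Rightarrow> 'a" where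
  "path_simplex n g =
     restrict ((\<lambda>t. \<lambda>i\<in>{1..n}. g (t i)) \<circ> ordered_coords n) (standard_simplex n)"

abbreviation HnXY :: "'a topology \<Rightarrow> 'a \<Rightarrow> 'a \<Rightarrow> nat \<Rightarrow> (nat \<Rightarrow> 'a) chain set monoid" where
  "HnXY X a b n \<equiv> relative_homology_group (int n) (power_space X n) (Yset X a b n)"

definition path_simplex_class ::
  "'a topology \<Rightarrow> 'a \<Rightarrow> 'a \<Rightarrow> nat \<Rightarrow> (real \<Rightarrow> 'a) \<Rightarrow> (nat \<Rightarrow> 'a) chain set" where
  "path_simplex_class X a b n g =
     homologous_rel_set n (power_space X n) (Yset X a b n) (frag_of (path_simplex n g))"

definition represents_path_simplices ::
  "'a topology \<Rightarrow> 'a \<Rightarrow> 'a \<Rightarrow> nat \<Rightarrow> ((real \<Rightarrow> 'a) set \<Rightarrow> (nat \<Rightarrow> 'a) chain set) \<Rightarrow> bool" where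
  "represents_path_simplices X a b n F \<longleftrightarrow>
     F \<in> pi1 X a b \<rightarrow>\<^sub>E carrier (HnXY X a b n) \<and>
     (\<forall>g\<in>Chem X a b. path_simplex_class X a b n g = F (path_class X g))"

end

(* A path from a to b is fed to the fixed relative cycle given by the identity simplex, which makes
   part (a) an instance of homotopy invariance of relative homology.  For part (b), choose loops
   representing the alpha_k that move only during pairwise disjoint closed time intervals J_k of one
   concatenated path, and replace the loops with index outside I by constant ones.  The n coordinates
   of a point of the simplex meet at most n of the n+1 intervals, so the open sets U_k on which no
   coordinate lies in J_k cover the simplex.  After an iterated barycentric subdivision every small
   simplex lies in some U_k, where the map does not depend on whether k belongs to I; so the
   subdivided alternating sum cancels simplex by simplex, already as a chain. *)

theory Submission
  imports Defs
begin

section \<open>Homotopies of paths\<close>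

text \<open>The moving intervals come from iterated halving: the head of a list of loops takes the
  second half of the time and the rest is squeezed into the first half. Each loop begins with a
  pause filling half of its slot, so with the final path appended loop \<open>k\<close> moves only
  for \<open>t\<close> in \<open>J_k = 2^-k * [3/8, 1/2]\<close>. The pauses make these closed
  intervals disjoint; without them neighbours would share an endpoint, one coordinate could meet two
  intervals, and the count of coordinates against intervals would fail. The subdivision takes place
  in the source simplex, on one chain common to all \<open>I\<close>; hence path simplices are
  treated throughout as images of the identity simplex. The factorization is then algebra: the
  \<open>k\<close>-th power of the augmentation ideal lies in the additive span of the products
  \<open>\<beta> (1 - \<alpha>_0) ... (1 - \<alpha>_{k-1})\<close>, the leading \<beta> is absorbed
  by \<gamma>, and for \<open>k = n + 1\<close> the expanded product is the alternating sum of
  (b).\<close>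

lemma path_homotopic_iff:
  "path_homotopic X p q \<longleftrightarrow>
    (\<exists>h. continuous_map (top_of_set ({0..1 :: real} \<times> {0..1})) X h \<and>
         (\<forall>t\<in>{0..1}. h (0, t) = p t) \<and> (\<forall>t\<in>{0..1}. h (1, t) = q t) \<and>
         (\<forall>s\<in>{0..1}. h (s, 0) = p 0 \<and> h (s, 1) = p 1))"
  unfolding path_homotopic_def
  by (subst homotopic_with) (simp_all add: prod_topology_subtopology_eu)

lemma path_homotopic_imp:
  assumes "path_homotopic X p q"
  shows "pathin X p" "pathin X q" "q 0 = p 0" "q 1 = p 1"
  using homotopic_with_imp_continuous_maps homotopic_with_imp_property assms
  unfolding path_homotopic_def pathin_def by blast+

lemma path_homotopic_refl: "pathin X p \<Longrightarrow> path_homotopic X p p"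
  by (simp add: path_homotopic_def pathin_def homotopic_with_refl)

lemma path_homotopic_sym:
  assumes "path_homotopic X p q"
  shows "path_homotopic X q p"
  using assms path_homotopic_imp(3,4)[OF assms]
  by (simp add: path_homotopic_def homotopic_with_symD)

lemma path_homotopic_trans:
  assumes "path_homotopic X p q" "path_homotopic X q r"
  shows "path_homotopic X p r"
proof -
  have "homotopic_with (\<lambda>r. r 0 = p 0 \<and> r 1 = p 1) (top_of_set {0..1}) X q r"
    using assms path_homotopic_imp(3,4)[OF assms(1)] by (simp add: path_homotopic_def)
  then show ?thesis
    using assms(1) unfolding path_homotopic_def by (rule homotopic_with_trans[rotated])
qed

text \<open>The straight-line homotopy from the identity to \<open>f\<close> stays in the unit
  interval by convexity and fixes both ends; \<open>p\<close> composed with it is the homotopy. The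
  unit and associativity laws for concatenation are the instances for piecewise linear
  \<open>f\<close>.\<close>

lemma path_homotopic_reparametrize:
  assumes p: "pathin X p" and f: "continuous_on {0..1} f" "f \<in> {0..1} \<rightarrow> {0..1}" "f 0 = 0" "f 1 = 1"
    and q: "\<And>t. t \<in> {0..1} \<Longrightarrow> q t = p (f t)"
  shows "path_homotopic X p q"
  unfolding path_homotopic_iff
proof (intro exI conjI ballI)
  let ?k = "\<lambda>z. (1 - fst z) * snd z + fst z * f (snd z)"
  have "?k \<in> {0..1} \<times> {0..1} \<rightarrow> {0..1}"
  proof
    fix z :: "real \<times> real" assume z: "z \<in> {0..1} \<times> {0..1}"
    then have fz: "f (snd z) \<in> {0..1}" using f(2) by auto
    have "(1 - fst z) *\<^sub>R snd z + fst z *\<^sub>R f (snd z) \<in> {0..1}"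
      by (rule convexD_alt) (use z fz in auto)
    then show "?k z \<in> {0..1}" by simp
  qed
  moreover have "continuous_on ({0..1} \<times> {0..1}) ?k"
    by (intro continuous_intros continuous_on_compose2[OF f(1)]) auto
  ultimately have "continuous_map (top_of_set ({0..1} \<times> {0..1})) (top_of_set {0..1}) ?k"
    by auto
  then show "continuous_map (top_of_set ({0..1} \<times> {0..1})) X (p \<circ> ?k)"
    using p unfolding pathin_def by (rule continuous_map_compose)
qed (use f q in auto)

lemma path_class_eq_iff:
  assumes "pathin X q"
  shows "path_class X p = path_class X q \<longleftrightarrow> path_homotopic X p q"
proof
  assume "path_class X p = path_class X q"
  then show "path_homotopic X p q"
    using path_homotopic_refl[OF assms] unfolding path_class_def by blast
next
  assume "path_homotopic X p q"
  then show "path_class X p = path_class X q"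
    unfolding path_class_def by (blast intro: path_homotopic_trans path_homotopic_sym)
qed

text \<open>The two homotopies are glued along the line \<open>snd z = 1/2\<close>. They agree there
  because both are stationary at the junction: one stays at \<open>p 1\<close>, the other at
  \<open>q 0\<close>.\<close>

lemma path_homotopic_then_path:
  assumes pp: "path_homotopic X p p'" and qq: "path_homotopic X q q'" and pq: "p 1 = q 0"
  shows "path_homotopic X (then_path p q) (then_path p' q')"
proof -
  let ?S = "{0..1} \<times> {0..1} :: (real \<times> real) set"
  obtain h where h: "continuous_map (top_of_set ?S) X h"
    "\<forall>t\<in>{0..1}. h (0, t) = p t" "\<forall>t\<in>{0..1}. h (1, t) = p' t"
    "\<forall>s\<in>{0..1}. h (s, 0) = p 0 \<and> h (s, 1) = p 1"
    using pp unfolding path_homotopic_iff by blast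
  obtain k where k: "continuous_map (top_of_set ?S) X k"
    "\<forall>t\<in>{0..1}. k (0, t) = q t" "\<forall>t\<in>{0..1}. k (1, t) = q' t"
    "\<forall>s\<in>{0..1}. k (s, 0) = q 0 \<and> k (s, 1) = q 1"
    using qq unfolding path_homotopic_iff by blast
  let ?H = "\<lambda>z. if snd z \<le> 1/2 then (h \<circ> (\<lambda>z. (fst z, 2 * snd z))) z
                 else (k \<circ> (\<lambda>z. (fst z, 2 * snd z - 1))) z"
  show ?thesis
    unfolding path_homotopic_iff
  proof (intro exI conjI ballI)
    show "continuous_map (top_of_set ?S) X ?H"
    proof (rule continuous_map_cases_le)
      show "continuous_map (top_of_set ?S) euclideanreal snd"
        by (simp add: continuous_on_snd)
      have "continuous_map (top_of_set (?S \<inter> {z. snd z \<le> 1/2})) (top_of_set ?S) (\<lambda>z. (fst z, 2 * snd z))"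
        by (auto intro!: continuous_intros)
      then show "continuous_map (subtopology (top_of_set ?S) {z \<in> topspace (top_of_set ?S). snd z \<le> 1/2})
          X (h \<circ> (\<lambda>z. (fst z, 2 * snd z)))"
        by (intro continuous_map_compose[OF _ h(1)])
          (auto simp: subtopology_subtopology Int_def conj_commute cong: conj_cong)
      have "continuous_map (top_of_set (?S \<inter> {z. 1/2 \<le> snd z})) (top_of_set ?S) (\<lambda>z. (fst z, 2 * snd z - 1))"
        by (auto intro!: continuous_intros)
      then show "continuous_map (subtopology (top_of_set ?S) {z \<in> topspace (top_of_set ?S). 1/2 \<le> snd z})
          X (k \<circ> (\<lambda>z. (fst z, 2 * snd z - 1)))"
        by (intro continuous_map_compose[OF _ k(1)])
          (auto simp: subtopology_subtopology Int_def conj_commute cong: conj_cong)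
      show "(h \<circ> (\<lambda>z. (fst z, 2 * snd z))) z = (k \<circ> (\<lambda>z. (fst z, 2 * snd z - 1))) z"
        if "z \<in> topspace (top_of_set ?S)" "snd z = 1/2" for z
        unfolding comp_def that(2) using that(1) h(4) k(4) pq by auto
    qed auto
  qed (use h k in \<open>auto simp: then_path_def\<close>)
qed

lemma then_path_Chem:
  assumes "p \<in> Chem X a b" "q \<in> Chem X b c"
  shows "then_path p q \<in> Chem X a c"
proof -
  \<comment> \<open>Continuity of the concatenation is the gluing result again, applied to constant
    homotopies: both ends of a homotopy are continuous paths.\<close>
  have "path_homotopic X (then_path p q) (then_path p q)"
    using assms by (intro path_homotopic_then_path path_homotopic_refl) (auto simp: Chem_def)
  then have "pathin X (then_path p q)"
    by (rule path_homotopic_imp)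
  then show ?thesis
    using assms by (auto simp: Chem_def then_path_def)
qed

lemma const_path_Chem: "a \<in> topspace X \<Longrightarrow> (\<lambda>_. a) \<in> Chem X a a"
  by (simp add: Chem_def pathin_const)

lemma path_homotopic_const_then_path:
  assumes "p \<in> Chem X a b"
  shows "path_homotopic X p (then_path (\<lambda>_. a) p)"
proof (rule path_homotopic_reparametrize[where f = "\<lambda>t. max 0 (2 * t - 1)"])
  show "continuous_on {0..1} (\<lambda>t. max 0 (2 * t - 1) :: real)"
    by (intro continuous_intros)
  show "then_path (\<lambda>_. a) p t = p (max 0 (2 * t - 1))" for t
    using assms by (cases "t \<le> 1/2") (auto simp: then_path_def Chem_def max_absorb1 max_absorb2)
qed (use assms in \<open>auto simp: Chem_def\<close>)

lemma path_homotopic_then_path_const: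
  assumes "p \<in> Chem X a b"
  shows "path_homotopic X p (then_path p (\<lambda>_. b))"
proof (rule path_homotopic_reparametrize[where f = "\<lambda>t. min (2 * t) 1"])
  show "continuous_on {0..1} (\<lambda>t. min (2 * t) 1 :: real)"
    by (intro continuous_intros)
  show "then_path p (\<lambda>_. b) t = p (min (2 * t) 1)" for t
    using assms by (cases "t \<le> 1/2") (auto simp: then_path_def Chem_def min_absorb1 min_absorb2)
qed (use assms in \<open>auto simp: Chem_def\<close>)

lemma path_homotopic_then_path_assoc:
  assumes "p \<in> Chem X a b" "q \<in> Chem X b c" "r \<in> Chem X c d"
  shows "path_homotopic X (then_path (then_path p q) r) (then_path p (then_path q r))"
proof (rule path_homotopic_reparametrize)
  \<comment> \<open>The piecewise linear map with slopes \<open>1/2\<close>, \<open>1\<close> and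
    \<open>2\<close> that matches the two ways of dividing the unit interval among three paths.
    Written with \<open>max\<close> and \<open>min\<close>, it is continuous by composition.\<close>
  let ?f = "\<lambda>t :: real. max (t / 2) (min (t - 1/4) 1 + max 0 (t - 3/4))"
  have f: "?f t = (if t \<le> 1/2 then t / 2 else if t \<le> 3/4 then t - 1/4 else 2 * t - 1)" if "t \<le> 1" for t
    using that by (auto simp: max_def min_def)
  show "continuous_on {0..1} ?f"
    by (intro continuous_intros) auto
  show "?f \<in> {0..1} \<rightarrow> {0..1}" "?f 0 = 0" "?f 1 = 1"
    by (auto simp: max_def min_def)
  have "then_path (then_path p q) r \<in> Chem X a d"
    using assms by (blast intro: then_path_Chem)
  then show "pathin X (then_path (then_path p q) r)"
    by (simp add: Chem_def)
  show "then_path p (then_path q r) t = then_path (then_path p q) r (?f t)" if "t \<in> {0..1}" for t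
  proof -
    consider "t \<le> 1/2" | "1/2 < t" "t \<le> 3/4" | "3/4 < t" by linarith
    then show ?thesis
      using that unfolding f[of t, OF atLeastAtMost_iff[THEN iffD1, THEN conjunct2, OF that]]
      by cases (auto simp: then_path_def algebra_simps)
  qed
qed

section \<open>Products of homotopy classes\<close>

lemma class_mult_path_class:
  assumes "p \<in> Chem X a b" "q \<in> Chem X b c"
  shows "class_mult X (path_class X q) (path_class X p) = path_class X (then_path p q)"
proof (intro equalityI subsetI)
  \<comment> \<open>Any two choices of representatives have homotopic concatenations, so the set of
    all products is one single class.\<close>
  fix r assume "r \<in> class_mult X (path_class X q) (path_class X p)"
  then obtain p' q' where "path_homotopic X q q'" "path_homotopic X p p'" "path_homotopic X (then_path p' q') r"
    by (auto simp: class_mult_def path_class_def)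
  then show "r \<in> path_class X (then_path p q)"
    using assms path_homotopic_then_path[of X p p' q q'] path_homotopic_trans
    unfolding path_class_def Chem_def by fastforce
next
  fix r assume "r \<in> path_class X (then_path p q)"
  moreover have "path_homotopic X q q" "path_homotopic X p p"
    using assms by (auto simp: Chem_def intro: path_homotopic_refl)
  ultimately show "r \<in> class_mult X (path_class X q) (path_class X p)"
    unfolding class_mult_def path_class_def by blast
qed

lemma path_class_eqI: "path_homotopic X p q \<Longrightarrow> path_class X p = path_class X q"
  using path_class_eq_iff path_homotopic_imp(2) by blast

lemma class_mult_closed:
  assumes "C \<in> pi1 X b c" "A \<in> pi1 X a b"
  shows "class_mult X C A \<in> pi1 X a c"
proof -
  obtain p q where "p \<in> Chem X a b" "A = path_class X p" "q \<in> Chem X b c" "C = path_class X q"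
    using assms by (auto simp: pi1_def)
  then show ?thesis
    by (auto simp: pi1_def class_mult_path_class intro: then_path_Chem)
qed

lemma class_mult_assoc:
  assumes "C \<in> pi1 X c d" "B \<in> pi1 X b c" "A \<in> pi1 X a b"
  shows "class_mult X (class_mult X C B) A = class_mult X C (class_mult X B A)"
proof -
  obtain p q r where Chem: "p \<in> Chem X a b" "q \<in> Chem X b c" "r \<in> Chem X c d"
    and classes: "A = path_class X p" "B = path_class X q" "C = path_class X r"
    using assms by (auto simp: pi1_def)
  have "then_path p q \<in> Chem X a c" "then_path q r \<in> Chem X b d"
    using Chem by (blast intro: then_path_Chem)+
  then show ?thesis
    unfolding classes using Chem path_class_eqI[OF path_homotopic_then_path_assoc[OF Chem]]
    by (simp add: class_mult_path_class)
qed

lemma pi1_group_simps [simp]: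
  "carrier (pi1_group X a) = pi1 X a a" "monoid.mult (pi1_group X a) = class_mult X"
  "\<one>\<^bsub>pi1_group X a\<^esub> = path_class X (\<lambda>_. a)"
  by (simp_all add: pi1_group_def)

lemma monoid_pi1_group:
  assumes "a \<in> topspace X"
  shows "monoid (pi1_group X a)"
proof
  note const = const_path_Chem[OF assms]
  show "\<one>\<^bsub>pi1_group X a\<^esub> \<in> carrier (pi1_group X a)"
    using const by (auto simp: pi1_def)
  \<comment> \<open>The right factor runs first, so the left unit law appends a constant path and
    the right unit law prepends one.\<close>
  fix A assume "A \<in> carrier (pi1_group X a)"
  then obtain p where p: "p \<in> Chem X a a" "A = path_class X p"
    by (auto simp: pi1_def)
  show "\<one>\<^bsub>pi1_group X a\<^esub> \<otimes>\<^bsub>pi1_group X a\<^esub> A = A"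
    unfolding pi1_group_simps p(2) class_mult_path_class[OF p(1) const]
    using path_homotopic_then_path_const[OF p(1)] by (rule path_class_eqI[symmetric])
  show "A \<otimes>\<^bsub>pi1_group X a\<^esub> \<one>\<^bsub>pi1_group X a\<^esub> = A"
    unfolding pi1_group_simps p(2) class_mult_path_class[OF const p(1)]
    using path_homotopic_const_then_path[OF p(1)] by (rule path_class_eqI[symmetric])
qed (auto simp: class_mult_assoc intro: class_mult_closed)

text \<open>The initial pause keeps the closed interval in which a loop moves away from the interval
  of the loop run just before it.\<close>

lemma pi1_representative_const_start:
  assumes "a \<in> topspace X" "A \<in> pi1 X a a"
  obtains g where "g \<in> Chem X a a" "path_class X g = A" "\<And>t. t \<le> 1/2 \<Longrightarrow> g t = a"
proof -
  obtain p where p: "p \<in> Chem X a a" "A = path_class X p"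
    using assms(2) by (auto simp: pi1_def)
  show ?thesis
  proof (rule that)
    show "then_path (\<lambda>_. a) p \<in> Chem X a a"
      using const_path_Chem[OF assms(1)] p(1) by (rule then_path_Chem)
    show "path_class X (then_path (\<lambda>_. a) p) = A"
      using path_class_eqI[OF path_homotopic_const_then_path[OF p(1)]] p(2) by simp
  qed (simp add: then_path_def)
qed

section \<open>Cancellation of alternating sums after subdivision\<close>

text \<open>Adding or removing \<open>i\<close> is an involution on the subsets of \<open>S\<close>
  that reverses the sign and preserves \<open>u\<close>, so the terms cancel in pairs.\<close>

lemma sum_alternating_Pow_eq_0:
  fixes u :: "'i set \<Rightarrow> 'b \<Rightarrow>\<^sub>0 int"
  assumes "finite S" "i \<in> S" and u: "\<And>I. I \<subseteq> S - {i} \<Longrightarrow> u (insert i I) = u I"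
  shows "(\<Sum>I\<in>Pow S. frag_cmul ((-1) ^ card I) (u I)) = 0"
proof -
  let ?R = "S - {i}" and ?v = "\<lambda>I. frag_cmul ((-1) ^ card I) (u I)"
  have inj: "inj_on (insert i) (Pow ?R)"
    by (auto simp: inj_on_def)
  have neg: "?v (insert i I) = - ?v I" if "I \<in> Pow ?R" for I
  proof -
    have "finite I" "i \<notin> I" using that assms(1) by (auto intro: finite_subset)
    then show ?thesis using that u[of I] by simp
  qed
  have "Pow S = Pow ?R \<union> insert i ` Pow ?R"
    using assms(2) Pow_insert[of i ?R] by (simp add: insert_absorb)
  then have "sum ?v (Pow S) = sum ?v (Pow ?R) + sum ?v (insert i ` Pow ?R)"
  proof (simp only:, intro sum.union_disjoint)
    show "Pow ?R \<inter> insert i ` Pow ?R = {}" by blast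
  qed (use assms(1) in auto)
  also have "sum ?v (insert i ` Pow ?R) = (\<Sum>I\<in>Pow ?R. - ?v I)"
    unfolding sum.reindex[OF inj] comp_def by (rule sum.cong[OF refl]) (rule neg)
  also have "\<dots> = - sum ?v (Pow ?R)"
    by (rule sum_negf)
  finally show ?thesis
    by (simp only: add.right_inverse)
qed

lemma frag_extend_sum_fun:
  assumes "finite A"
  shows "frag_extend (\<lambda>x. \<Sum>i\<in>A. f i x) c = (\<Sum>i\<in>A. frag_extend (f i) c)"
  unfolding frag_extend_def frag_cmul_sum by (rule sum.swap)

lemma frag_extend_cmul_fun:
  "frag_extend (\<lambda>x. frag_cmul k (f x)) c = frag_cmul k (frag_extend f c)"
  unfolding frag_extend_def frag_cmul_sum by (simp add: mult.commute)

lemma frag_cmul_diff: "frag_cmul k (a - b) = frag_cmul k a - frag_cmul k b"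
  by (simp add: poly_mapping_eqI lookup_minus right_diff_distrib)

lemma singular_relboundary_sum:
  "(\<And>i. i \<in> A \<Longrightarrow> singular_relboundary p X S (f i)) \<Longrightarrow> singular_relboundary p X S (sum f A)"
  by (induction A rule: infinite_finite_induct) (auto intro: singular_relboundary_add)

text \<open>The chain \<open>c'\<close> subordinate to the cover is chosen once, before
  \<open>I\<close>. Each map of pairs \<open>f I\<close> carries the relative boundary
  \<open>c - c'\<close> to a relative boundary, so modulo these the sum may be computed on
  \<open>c'\<close>.\<close>

lemma alternating_sum_relboundary:
  fixes f :: "'i set \<Rightarrow> 'b \<Rightarrow> 'c"
  assumes S: "finite S" and c: "singular_relcycle n T B c"
    and U: "\<And>i. i \<in> S \<Longrightarrow> openin T (U i)" "topspace T \<subseteq> (\<Union>i\<in>S. U i)"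
    and f: "\<And>I. I \<subseteq> S \<Longrightarrow> continuous_map T Z (f I)" "\<And>I. I \<subseteq> S \<Longrightarrow> f I \<in> B \<rightarrow> Y"
    and indep: "\<And>i I x. \<lbrakk>i \<in> S; I \<subseteq> S - {i}; x \<in> U i\<rbrakk> \<Longrightarrow> f (insert i I) x = f I x"
  shows "singular_relboundary n Z Y (\<Sum>I\<in>Pow S. frag_cmul ((-1) ^ card I) (chain_map n (f I) c))"
proof -
  have "openin T V" if "V \<in> U ` S" for V
    using that U(1) by blast
  then obtain c' where c': "homologous_rel n T B c c'"
    "\<And>s. s \<in> Poly_Mapping.keys c' \<Longrightarrow> \<exists>V\<in>U ` S. s \<in> standard_simplex n \<rightarrow> V"
    using small_homologous_rel_relcycle_exists[OF _ U(2) c] by metis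
  \<comment> \<open>Interchanging the sum over \<open>I\<close> with the linear extension over the
    simplices of \<open>c'\<close> lets each simplex cancel by means of an index of its own.\<close>
  have "(\<Sum>I\<in>Pow S. frag_cmul ((-1) ^ card I) (chain_map n (f I) c'))
      = frag_extend (\<lambda>s. \<Sum>I\<in>Pow S. frag_cmul ((-1) ^ card I) (frag_of (simplex_map n (f I) s))) c'"
    using S by (simp add: frag_extend_sum_fun frag_extend_cmul_fun chain_map_def comp_def)
  also have "\<dots> = 0"
  proof (rule frag_extend_eq_0)
    fix s assume "s \<in> Poly_Mapping.keys c'"
    then obtain i where i: "i \<in> S" "s \<in> standard_simplex n \<rightarrow> U i"
      using c'(2) by blast
    have "simplex_map n (f (insert i I)) s = simplex_map n (f I) s" if "I \<subseteq> S - {i}" for I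
      unfolding simplex_map_def by (rule restrict_ext) (use i(2) indep[OF i(1) that] in \<open>auto simp: Pi_iff\<close>)
    then show "(\<Sum>I\<in>Pow S. frag_cmul ((-1) ^ card I) (frag_of (simplex_map n (f I) s))) = 0"
      by (intro sum_alternating_Pow_eq_0[OF S i(1)]) simp
  qed
  finally have c'0: "(\<Sum>I\<in>Pow S. frag_cmul ((-1) ^ card I) (chain_map n (f I) c')) = 0" .
  have "(\<Sum>I\<in>Pow S. frag_cmul ((-1) ^ card I) (chain_map n (f I) c))
        - (\<Sum>I\<in>Pow S. frag_cmul ((-1) ^ card I) (chain_map n (f I) c'))
      = (\<Sum>I\<in>Pow S. frag_cmul ((-1) ^ card I) (chain_map n (f I) (c - c')))"
    by (simp add: chain_map_diff frag_cmul_diff flip: sum_subtractf)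
  moreover have "singular_relboundary n Z Y (frag_cmul ((-1) ^ card I) (chain_map n (f I) (c - c')))"
    if "I \<in> Pow S" for I
    using that c'(1) f[of I] unfolding homologous_rel_def
    by (intro singular_relboundary_cmul singular_relboundary_chain_map) auto
  then have "singular_relboundary n Z Y
      (\<Sum>I\<in>Pow S. frag_cmul ((-1) ^ card I) (chain_map n (f I) (c - c')))"
    by (rule singular_relboundary_sum)
  ultimately show ?thesis
    using c'0 by simp
qed

section \<open>The simplex of a path\<close>

abbreviation simplex_space :: "nat \<Rightarrow> (nat \<Rightarrow> real) topology" where
  "simplex_space n \<equiv> subtopology (powertop_real UNIV) (standard_simplex n)"

abbreviation identity_simplex :: "nat \<Rightarrow> (nat \<Rightarrow> real) \<Rightarrow> nat \<Rightarrow> real" where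
  "identity_simplex n \<equiv> restrict id (standard_simplex n)"

definition simplex_boundary :: "nat \<Rightarrow> (nat \<Rightarrow> real) set" where
  "simplex_boundary n = {x \<in> standard_simplex n. \<exists>i\<le>n. x i = 0}"

text \<open>The path simplex as a map of spaces, not yet restricted to a singular simplex; in this
  form it acts on all chains of the standard simplex.\<close>

definition simplex_to_power :: "nat \<Rightarrow> (real \<Rightarrow> 'a) \<Rightarrow> (nat \<Rightarrow> real) \<Rightarrow> nat \<Rightarrow> 'a" where
  "simplex_to_power n g x = (\<lambda>j\<in>{1..n}. g (ordered_coords n x j))"

lemma path_simplex_eq: "path_simplex n g = simplex_map n (simplex_to_power n g) (identity_simplex n)"
  unfolding path_simplex_def simplex_map_def simplex_to_power_def
  by (rule restrict_ext) simp

lemma ordered_coords_unit_interval: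
  assumes "x \<in> standard_simplex n" "j \<in> {1..n}"
  shows "ordered_coords n x j \<in> {0..1}"
proof -
  have "(\<Sum>l<j. x l) \<le> (\<Sum>l\<le>n. x l)"
    using assms by (intro sum_mono2) (auto simp: standard_simplex_def)
  then show ?thesis
    using assms by (auto simp: ordered_coords_def standard_simplex_def sum_nonneg)
qed

lemma continuous_map_ordered_coord:
  assumes "j \<in> {1..n}"
  shows "continuous_map (simplex_space n) (top_of_set {0..1}) (\<lambda>x. ordered_coords n x j)"
proof -
  have "continuous_map (powertop_real UNIV) euclideanreal (\<lambda>x. \<Sum>l<j. x l)"
    by (auto intro!: continuous_map_sum continuous_map_product_projection)
  then have "continuous_map (powertop_real UNIV) euclideanreal (\<lambda>x. ordered_coords n x j)"
    using assms by (simp add: ordered_coords_def)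
  then show ?thesis
    using ordered_coords_unit_interval[OF _ assms]
    by (auto simp: continuous_map_in_subtopology continuous_map_from_subtopology)
qed

lemma continuous_map_simplex_to_power:
  assumes "pathin X g"
  shows "continuous_map (simplex_space n) (power_space X n) (simplex_to_power n g)"
  unfolding continuous_map_componentwise
proof (intro conjI ballI)
  fix j assume j: "j \<in> {1..n}"
  have "continuous_map (simplex_space n) X (g \<circ> (\<lambda>x. ordered_coords n x j))"
    using continuous_map_ordered_coord[OF j] assms unfolding pathin_def
    by (rule continuous_map_compose)
  then show "continuous_map (simplex_space n) X (\<lambda>x. simplex_to_power n g x j)"
    using j by (simp add: simplex_to_power_def comp_def)
qed (auto simp: simplex_to_power_def)

text \<open>The empty sum of barycentric coordinates is 0 and the full sum is 1, so the conventional
  entries at positions \<open>0\<close> and \<open>n + 1\<close> are values of \<open>g\<close> like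
  all the others. The first and last face then need no separate treatment.\<close>

lemma with_ends_simplex_to_power:
  assumes "g 0 = a" "g 1 = b" "x \<in> standard_simplex n" "i \<le> n + 1"
  shows "with_ends n a b (simplex_to_power n g x) i = g (\<Sum>l<i. x l)"
  using assms with_ends_ordered_coords[OF assms(3,4)]
  by (auto simp: with_ends_def simplex_to_power_def split: if_splits)

text \<open>A vanishing barycentric coordinate \<open>x i\<close> makes two consecutive partial sums
  equal, hence two consecutive values of \<open>g\<close>.\<close>

lemma simplex_to_power_boundary:
  assumes "g \<in> Chem X a b"
  shows "simplex_to_power n g \<in> simplex_boundary n \<rightarrow> Yset X a b n"
proof
  fix x assume "x \<in> simplex_boundary n"
  then obtain i where i: "x \<in> standard_simplex n" "i \<le> n" "x i = 0"
    by (auto simp: simplex_boundary_def)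
  have "simplex_to_power n g x \<in> topspace (power_space X n)"
    using assms i continuous_map_simplex_to_power[of X g n]
    by (auto simp: Chem_def continuous_map_def)
  moreover have "with_ends n a b (simplex_to_power n g x) i = with_ends n a b (simplex_to_power n g x) (i + 1)"
    using with_ends_simplex_to_power[of g a b x n] i assms by (auto simp: Chem_def)
  ultimately show "simplex_to_power n g x \<in> Yset X a b n"
    using i(2) by (auto simp: Yset_def)
qed

text \<open>The \<open>k\<close>-th face inclusion inserts a zero at position \<open>k\<close>, so
  each face lands where a barycentric coordinate vanishes.\<close>

lemma singular_relcycle_identity_simplex:
  "singular_relcycle n (simplex_space n) (simplex_boundary n) (frag_of (identity_simplex n))"
proof -
  have id: "singular_simplex n (simplex_space n) (identity_simplex n)"
    by (simp add: singular_simplex_def continuous_map_eq[OF continuous_map_id])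
  have "singular_simplex (n - 1) (subtopology (simplex_space n) (simplex_boundary n))
      (singular_face n k (identity_simplex n))"
    if "n \<noteq> 0" "k \<le> n" for k
    unfolding singular_simplex_subtopology[of _ "simplex_space n"]
  proof
    show "singular_simplex (n - 1) (simplex_space n) (singular_face n k (identity_simplex n))"
      using singular_simplex_singular_face[OF id, of k] that by simp
    have "simplical_face k x \<in> simplex_boundary n" if "x \<in> standard_simplex (n - Suc 0)" for x
      using simplical_face_in_standard_simplex[of n k x] that \<open>n \<noteq> 0\<close> \<open>k \<le> n\<close>
      by (auto simp: simplex_boundary_def simplical_face_def)
    then show "singular_face n k (identity_simplex n) ` standard_simplex (n - 1) \<subseteq> simplex_boundary n"
      using simplical_face_in_standard_simplex[of n k] that by (auto simp: singular_face_def)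
  qed
  then show ?thesis
    unfolding singular_relcycle chain_boundary_of
    using id by (auto simp: singular_chain_of intro!: singular_chain_sum singular_chain_cmul)
qed

lemma chain_map_identity_simplex:
  "chain_map n (simplex_to_power n g) (frag_of (identity_simplex n)) = frag_of (path_simplex n g)"
  by (simp add: path_simplex_eq)

lemma singular_relcycle_path_simplex:
  assumes "g \<in> Chem X a b"
  shows "singular_relcycle n (power_space X n) (Yset X a b n) (frag_of (path_simplex n g))"
  unfolding chain_map_identity_simplex[symmetric]
  using assms
  by (intro singular_relcycle_chain_map[OF singular_relcycle_identity_simplex]
      continuous_map_simplex_to_power simplex_to_power_boundary) (auto simp: Chem_def)

text \<open>Fixed endpoints are what makes this a homotopy of maps of pairs: every intermediate path
  again runs from \<open>a\<close> to \<open>b\<close>, so it sends the boundary of the simplex into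
  \<open>Yset\<close>.\<close>

lemma homologous_rel_path_simplex:
  assumes g: "g \<in> Chem X a b" and hom: "path_homotopic X g g'"
  shows "homologous_rel n (power_space X n) (Yset X a b n)
           (frag_of (path_simplex n g)) (frag_of (path_simplex n g'))"
proof -
  let ?I = "top_of_set {0..1 :: real}"
  obtain h where h: "continuous_map (prod_topology ?I ?I) X h"
    "\<forall>t\<in>{0..1}. h (0, t) = g t" "\<forall>t\<in>{0..1}. h (1, t) = g' t"
    "\<forall>s\<in>{0..1}. h (s, 0) = g 0 \<and> h (s, 1) = g 1"
    using hom unfolding path_homotopic_iff prod_topology_subtopology_eu by blast
  let ?H = "\<lambda>z. simplex_to_power n (\<lambda>t. h (fst z, t)) (snd z)"
  have "homotopic_with (\<lambda>k. k \<in> simplex_boundary n \<rightarrow> Yset X a b n) (simplex_space n) (power_space X n)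
      (simplex_to_power n g) (simplex_to_power n g')"
  proof (subst homotopic_with)
    show "(k \<in> simplex_boundary n \<rightarrow> Yset X a b n) = (k' \<in> simplex_boundary n \<rightarrow> Yset X a b n)"
      if "\<And>x. x \<in> topspace (simplex_space n) \<Longrightarrow> k x = k' x" for k k'
      using that by (auto simp: simplex_boundary_def Pi_iff)
    show "\<exists>H. continuous_map (prod_topology ?I (simplex_space n)) (power_space X n) H \<and>
        (\<forall>x\<in>topspace (simplex_space n). H (0, x) = simplex_to_power n g x) \<and>
        (\<forall>x\<in>topspace (simplex_space n). H (1, x) = simplex_to_power n g' x) \<and>
        (\<forall>s\<in>{0..1}. (\<lambda>x. H (s, x)) \<in> simplex_boundary n \<rightarrow> Yset X a b n)"
    proof (intro exI[of _ ?H] conjI ballI)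
      show "continuous_map (prod_topology ?I (simplex_space n)) (power_space X n) ?H"
        unfolding continuous_map_componentwise
      proof (intro conjI ballI)
        fix j assume j: "j \<in> {1..n}"
        have "continuous_map (prod_topology ?I (simplex_space n)) (prod_topology ?I ?I)
            (\<lambda>z. (fst z, ordered_coords n (snd z) j))"
          unfolding continuous_map_pairwise comp_def fst_conv snd_conv
          using continuous_map_compose[OF continuous_map_snd continuous_map_ordered_coord[OF j]]
          by (simp add: comp_def continuous_map_fst)
        from continuous_map_compose[OF this h(1)]
        show "continuous_map (prod_topology ?I (simplex_space n)) X (\<lambda>z. ?H z j)"
          using j by (simp add: simplex_to_power_def comp_def)
      qed (auto simp: simplex_to_power_def)
      show "?H (0, x) = simplex_to_power n g x" if "x \<in> topspace (simplex_space n)" for x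
        using h(2) ordered_coords_unit_interval[of x n] that
        by (auto simp: simplex_to_power_def fun_eq_iff)
      show "?H (1, x) = simplex_to_power n g' x" if "x \<in> topspace (simplex_space n)" for x
        using h(3) ordered_coords_unit_interval[of x n] that
        by (auto simp: simplex_to_power_def fun_eq_iff)
      show "(\<lambda>x. ?H (s, x)) \<in> simplex_boundary n \<rightarrow> Yset X a b n" if s: "s \<in> {0..1}" for s
      proof -
        have "continuous_map ?I X (h \<circ> Pair s)"
          using s by (intro continuous_map_o_Pair[OF h(1)]) simp
        then have "(\<lambda>t. h (s, t)) \<in> Chem X a b"
          using g h(4) s by (auto simp: Chem_def pathin_def comp_def)
        from simplex_to_power_boundary[OF this, of n] show ?thesis
          by simp
      qed
    qed
  qed
  from homotopic_imp_homologous_rel_chain_maps[OF this singular_relcycle_identity_simplex]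
  show ?thesis
    by (simp only: chain_map_identity_simplex)
qed

section \<open>Concatenated loops\<close>

text \<open>The head of the list runs last. This agrees with the product of classes, whose rightmost
  factor runs first, so a list and the product of its classes are read in the same order.\<close>

definition loop_path :: "'a \<Rightarrow> ('k \<Rightarrow> real \<Rightarrow> 'a) \<Rightarrow> 'k list \<Rightarrow> real \<Rightarrow> 'a" where
  "loop_path a e ks = foldr (\<lambda>k p. then_path p (e k)) ks (\<lambda>_. a)"

lemma loop_path_simps [simp]:
  "loop_path a e [] = (\<lambda>_. a)"
  "loop_path a e (k # ks) = then_path (loop_path a e ks) (e k)"
  by (simp_all add: loop_path_def)

lemma loop_path_Chem:
  assumes "a \<in> topspace X" "\<And>k. k \<in> set ks \<Longrightarrow> e k \<in> Chem X a a"
  shows "loop_path a e ks \<in> Chem X a a"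
  using assms(2) by (induction ks) (auto intro: const_path_Chem[OF assms(1)] then_path_Chem)

text \<open>A loop left out keeps its slot as a constant path, so the time intervals of the others
  do not depend on \<open>I\<close>. Up to homotopy the empty slots can be deleted, which recovers
  the product over \<open>I\<close>.\<close>

lemma loop_path_filter:
  assumes "a \<in> topspace X" "\<And>k. k \<in> set ks \<Longrightarrow> e k \<in> Chem X a a"
  shows "path_homotopic X (loop_path a (\<lambda>k. if k \<in> I then e k else (\<lambda>_. a)) ks)
           (loop_path a e (filter (\<lambda>k. k \<in> I) ks))"
  using assms(2)
proof (induction ks)
  case Nil
  then show ?case
    using const_path_Chem[OF assms(1)] by (auto simp: Chem_def intro: path_homotopic_refl)
next
  case (Cons k ks)
  let ?p = "loop_path a (\<lambda>k. if k \<in> I then e k else (\<lambda>_. a)) ks"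
  let ?q = "loop_path a e (filter (\<lambda>k. k \<in> I) ks)"
  have IH: "path_homotopic X ?p ?q"
    using Cons by simp
  have p: "?p \<in> Chem X a a"
    using Cons.prems by (intro loop_path_Chem assms(1)) (auto intro: const_path_Chem[OF assms(1)])
  show ?case
  proof (cases "k \<in> I")
    case True
    have "e k \<in> Chem X a a"
      using Cons.prems by simp
    then show ?thesis
      using IH p True by (auto simp: Chem_def intro!: path_homotopic_then_path path_homotopic_refl)
  next
    case False
    have "path_homotopic X (then_path ?p (\<lambda>_. a)) ?p"
      using path_homotopic_then_path_const[OF p] by (rule path_homotopic_sym)
    from path_homotopic_trans[OF this IH] False show ?thesis
      by simp
  qed
qed

text \<open>The loop at position \<open>i\<close> only moves while the time \<open>t\<close> satisfies \<open>3/4 \<le> 2\<^sup>i t \<le> 1\<close>.\<close>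

lemma loop_path_indep:
  assumes "\<And>k s. s \<le> 1/2 \<Longrightarrow> e k s = a" "\<And>k s. s \<le> 1/2 \<Longrightarrow> e' k s = a" "t \<le> 1"
    and "\<And>i. \<lbrakk>i < length ks; e (ks ! i) \<noteq> e' (ks ! i)\<rbrakk> \<Longrightarrow> 2 ^ i * t \<notin> {3/4..1}"
  shows "loop_path a e ks t = loop_path a e' ks t"
  using assms(3,4)
proof (induction ks arbitrary: t)
  case (Cons k ks)
  show ?case
  proof (cases "t \<le> 1/2")
    case True
    have "loop_path a e ks (2 * t) = loop_path a e' ks (2 * t)"
    proof (rule Cons.IH)
      show "2 ^ i * (2 * t) \<notin> {3/4..1}" if "i < length ks" "e (ks ! i) \<noteq> e' (ks ! i)" for i
        using Cons.prems(2)[of "Suc i"] that by (simp add: mult.assoc mult.left_commute)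
    qed (use True in simp)
    with True show ?thesis
      by (simp add: then_path_def)
  next
    case False
    have "e k (2 * t - 1) = e' k (2 * t - 1)"
    proof (cases "e k = e' k")
      case False
      \<comment> \<open>The hypothesis at position 0 excludes \<open>t\<close> from
        \<open>{3/4..1}\<close>. Hence \<open>2 * t - 1\<close> lies in the first half of the head
        loop, where both versions rest at \<open>a\<close>.\<close>
      then have "t < 3/4"
        using Cons.prems(1) Cons.prems(2)[of 0] by auto
      then show ?thesis
        using assms(1,2) by simp
    qed simp
    with False show ?thesis
      by (simp add: then_path_def)
  qed
qed simp

lemma alternating_loop_paths_relboundary:
  assumes a: "a \<in> topspace X" and c: "c \<in> Chem X a b"
    and g: "\<And>k. k \<in> {0..n} \<Longrightarrow> g k \<in> Chem X a a" and g0: "\<And>k t. t \<le> 1/2 \<Longrightarrow> g k t = a"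
  shows "singular_relboundary n (power_space X n) (Yset X a b n)
    (\<Sum>I\<in>Pow {0..n}. frag_cmul ((-1) ^ card I) (frag_of (path_simplex n
       (then_path (loop_path a (\<lambda>k. if k \<in> I then g k else (\<lambda>_. a)) [0..<Suc n]) c))))"
proof -
  define e where "e = (\<lambda>I k. if k \<in> I then g k else (\<lambda>_. a))"
  define \<beta> where "\<beta> = (\<lambda>I. then_path (loop_path a (e I) [0..<Suc n]) c)"
  \<comment> \<open>Appending \<open>c\<close> halves the time once more, so the interval
    \<open>{3/4..1}\<close> for \<open>2 ^ k * t\<close> becomes \<open>{3/8..1/2}\<close>. It
    includes its endpoints, so that the complement taken here is open.\<close>
  define U where "U = (\<lambda>k::nat. topspace (simplex_space n) -
      (\<Union>j\<in>{1..n}. {x \<in> topspace (simplex_space n). ordered_coords n x j \<in> {t\<in>{0..1}. 2 ^ k * t \<in> {3/8..1/2}}}))"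
  have e_Chem: "e I k \<in> Chem X a a" if "k \<in> {0..n}" for I k
    using g[OF that] const_path_Chem[OF a] by (simp add: e_def)
  have \<beta>: "\<beta> I \<in> Chem X a b" for I
    unfolding \<beta>_def using e_Chem by (intro then_path_Chem[OF _ c] loop_path_Chem a) auto
  have "singular_relboundary n (power_space X n) (Yset X a b n)
    (\<Sum>I\<in>Pow {0..n}. frag_cmul ((-1) ^ card I)
       (chain_map n (simplex_to_power n (\<beta> I)) (frag_of (identity_simplex n))))"
  proof (rule alternating_sum_relboundary[OF _ singular_relcycle_identity_simplex])
    show "openin (simplex_space n) (U k)" for k
      unfolding U_def
    proof (intro openin_diff openin_topspace closedin_Union ballI)
      fix C assume "C \<in> (\<lambda>j. {x \<in> topspace (simplex_space n).
          ordered_coords n x j \<in> {t\<in>{0..1}. 2 ^ k * t \<in> {3/8..1/2}}}) ` {1..n}"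
      then obtain j where j: "j \<in> {1..n}" and C: "C = {x \<in> topspace (simplex_space n).
          ordered_coords n x j \<in> {t\<in>{0..1}. 2 ^ k * t \<in> {3/8..1/2}}}"
        by blast
      have "closed ((\<lambda>t. 2 ^ k * t) -` {3/8..1/2 :: real})"
        by (intro closed_vimage closed_atLeastAtMost continuous_intros)
      then have "closedin (top_of_set {0..1}) ({0..1} \<inter> ((\<lambda>t. 2 ^ k * t) -` {3/8..1/2 :: real}))"
        by (rule closedin_closed_Int)
      also have "{0..1} \<inter> ((\<lambda>t. 2 ^ k * t) -` {3/8..1/2 :: real}) = {t\<in>{0..1}. 2 ^ k * t \<in> {3/8..1/2}}"
        by auto
      finally show "closedin (simplex_space n) C"
        unfolding C by (rule closedin_continuous_map_preimage[OF continuous_map_ordered_coord[OF j]])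
    qed auto
    show "topspace (simplex_space n) \<subseteq> (\<Union>k\<in>{0..n}. U k)"
    proof
      fix x assume x: "x \<in> topspace (simplex_space n)"
      show "x \<in> (\<Union>k\<in>{0..n}. U k)"
      proof (rule ccontr)
        assume "x \<notin> (\<Union>k\<in>{0..n}. U k)"
        then have "\<forall>k\<in>{0..n}. \<exists>j\<in>{1..n}. 2 ^ k * ordered_coords n x j \<in> {3/8..1/2}"
          using x unfolding U_def by blast
        then obtain j where j: "\<And>k. k \<in> {0..n} \<Longrightarrow> j k \<in> {1..n} \<and> 2 ^ k * ordered_coords n x (j k) \<in> {3/8..1/2}"
          by metis
        \<comment> \<open>The intervals are disjoint because \<open>2 * 3/8 > 1/2\<close>: a time
          \<open>t\<close> with \<open>2 ^ k * t \<ge> 3/8\<close> has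
          \<open>2 ^ l * t \<ge> 3/4\<close> for every \<open>l > k\<close>.\<close>
        have "j k \<noteq> j l" if kl: "k \<in> {0..n}" "l \<in> {0..n}" "k < l" for k l
        proof
          assume eq: "j k = j l"
          let ?t = "ordered_coords n x (j k)"
          have "(2::real) ^ Suc k \<le> 2 ^ l"
            using kl(3) by (intro power_increasing) auto
          moreover have "0 \<le> ?t"
            using ordered_coords_unit_interval[of x n "j k"] x j[OF kl(1)] by auto
          ultimately have "2 ^ Suc k * ?t \<le> 2 ^ l * ?t"
            by (rule mult_right_mono)
          then show False
            using j[OF kl(1)] j[OF kl(2)] eq by auto
        qed
        then have "inj_on j {0..n}"
          by (metis inj_onI linorder_neqE_nat)
        moreover have "j ` {0..n} \<subseteq> {1..n}"
          using j by blast
        ultimately have "card {0..n} \<le> card {1..n}"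
          by (intro card_inj_on_le) auto
        then show False
          by simp
      qed
    qed
    show "continuous_map (simplex_space n) (power_space X n) (simplex_to_power n (\<beta> I))" for I
      using \<beta>[of I] by (intro continuous_map_simplex_to_power) (simp add: Chem_def)
    show "simplex_to_power n (\<beta> I) \<in> simplex_boundary n \<rightarrow> Yset X a b n" for I
      by (rule simplex_to_power_boundary[OF \<beta>])
    show "simplex_to_power n (\<beta> (insert k I)) x = simplex_to_power n (\<beta> I) x"
      if "k \<in> {0..n}" "x \<in> U k" for k I x
    proof -
      have "\<beta> (insert k I) t = \<beta> I t" if t: "t \<in> {0..1}" "2 ^ k * t \<notin> {3/8..1/2}" for t
      proof (cases "t \<le> 1/2")
        case True
        have "loop_path a (e (insert k I)) [0..<Suc n] (2 * t) = loop_path a (e I) [0..<Suc n] (2 * t)"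
        proof (rule loop_path_indep)
          fix i assume i: "i < length [0..<Suc n]"
            "e (insert k I) ([0..<Suc n] ! i) \<noteq> e I ([0..<Suc n] ! i)"
          \<comment> \<open>The list contains every index up to \<open>n\<close>, so position and
            index coincide, and only position \<open>k\<close> can distinguish the two
            families.\<close>
          then have "[0..<Suc n] ! i = i"
            by (subst nth_upt) auto
          then have "i = k"
            using i(2) by (auto simp: e_def split: if_splits)
          then show "2 ^ i * (2 * t) \<notin> {3/4..1}"
            using t(2) by auto
        qed (use True g0 in \<open>auto simp: e_def\<close>)
        with True show ?thesis
          by (simp add: \<beta>_def then_path_def)
      qed (simp add: \<beta>_def then_path_def)
      then show ?thesis
        using ordered_coords_unit_interval[of x n] that(2)
        by (auto simp: simplex_to_power_def U_def fun_eq_iff)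
    qed
  qed simp
  then show ?thesis
    unfolding chain_map_identity_simplex \<beta>_def e_def .
qed

section \<open>Powers of the augmentation ideal\<close>

text \<open>The additive subgroup generated by \<open>S\<close>. Closure under differences as the
  only operation mirrors \<open>frag_induction\<close>, so that both inductions have the same three
  cases.\<close>

inductive_set int_span :: "('a \<Rightarrow>\<^sub>0 int) set \<Rightarrow> ('a \<Rightarrow>\<^sub>0 int) set" for S where
  zero: "0 \<in> int_span S"
| base: "s \<in> S \<Longrightarrow> s \<in> int_span S"
| diff: "x \<in> int_span S \<Longrightarrow> y \<in> int_span S \<Longrightarrow> x - y \<in> int_span S"

lemma int_span_uminus: "x \<in> int_span S \<Longrightarrow> - x \<in> int_span S"
  using int_span.diff[OF int_span.zero] by simp

lemma int_span_add: "x \<in> int_span S \<Longrightarrow> y \<in> int_span S \<Longrightarrow> x + y \<in> int_span S"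
  using int_span.diff[OF _ int_span_uminus] by fastforce

lemma int_span_frag_of:
  assumes "Poly_Mapping.keys c \<subseteq> A"
  shows "c \<in> int_span (frag_of ` A)"
  using assms by (induction c rule: frag_induction) (auto intro: int_span.intros)

lemma frag_extend_diff_fun: "frag_extend (\<lambda>x. f x - g x) c = frag_extend f c - frag_extend g c"
  by (simp add: frag_extend_def frag_cmul_diff sum_subtractf)

lemma frag_bilinear_simps:
  "frag_bilinear m 0 d = 0"
  "frag_bilinear m c 0 = 0"
  "frag_bilinear m (c - c') d = frag_bilinear m c d - frag_bilinear m c' d"
  "frag_bilinear m c (d - d') = frag_bilinear m c d - frag_bilinear m c d'"
  by (simp_all add: frag_bilinear_def frag_extend_diff frag_extend_diff_fun frag_extend_eq_0)

lemma frag_bilinear_frag_of_sum: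
  assumes "finite A"
  shows "frag_bilinear m (frag_of x) (\<Sum>i\<in>A. frag_cmul (k i) (frag_of (f i)))
       = (\<Sum>i\<in>A. frag_cmul (k i) (frag_of (m x (f i))))"
  using assms by (simp add: frag_bilinear_def frag_extend_sum comp_def frag_extend_cmul)

lemma frag_bilinear_sum_frag_of:
  assumes "finite A"
  shows "frag_bilinear m (\<Sum>i\<in>A. frag_cmul (k i) (frag_of (f i))) (frag_of y)
       = (\<Sum>i\<in>A. frag_cmul (k i) (frag_of (m (f i) y)))"
  using assms by (simp add: frag_bilinear_def frag_extend_sum comp_def frag_extend_cmul)

lemma frag_bilinear_int_span:
  assumes "x \<in> int_span S" "y \<in> int_span T"
    and "\<And>s t. s \<in> S \<Longrightarrow> t \<in> T \<Longrightarrow> frag_bilinear m s t \<in> int_span R"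
  shows "frag_bilinear m x y \<in> int_span R"
  using assms(1)
proof induction
  case (base s)
  show ?case
    using assms(2) by induction (auto simp: frag_bilinear_simps assms(3) base intro: int_span.intros)
qed (auto simp: frag_bilinear_simps intro: int_span.intros)

lemma augmentation_superset:
  assumes "finite A" "Poly_Mapping.keys c \<subseteq> A"
  shows "augmentation c = (\<Sum>x\<in>A. Poly_Mapping.lookup c x)"
  unfolding augmentation_def using assms by (intro sum.mono_neutral_left) (auto simp: in_keys_iff)

lemma augmentation_diff: "augmentation (c - d) = augmentation c - augmentation d"
proof -
  let ?A = "Poly_Mapping.keys c \<union> Poly_Mapping.keys d"
  have "Poly_Mapping.keys (c - d) \<subseteq> ?A"
    by (rule keys_diff)
  then show ?thesis
    using augmentation_superset[of ?A c] augmentation_superset[of ?A d] augmentation_superset[of ?A "c - d"]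
    by (simp add: lookup_minus sum_subtractf)
qed

context monoid
begin

text \<open>Subtracting the augmentation times the unit projects onto the augmentation ideal. The
  claim is made for every \<open>c\<close> because \<open>augmentation c = 0\<close> is not
  inherited by the pieces in an induction over \<open>c\<close>.\<close>

lemma diff_augmentation_int_span:
  assumes "Poly_Mapping.keys c \<subseteq> carrier G"
  shows "c - frag_cmul (augmentation c) (frag_of \<one>) \<in> int_span ((\<lambda>g. frag_of \<one> - frag_of g) ` carrier G)"
  using assms
proof (induction c rule: frag_induction)
  case zero
  then show ?case
    by (simp add: augmentation_def int_span.zero)
next
  case (one x)
  then have "- (frag_of \<one> - frag_of x) \<in> int_span ((\<lambda>g. frag_of \<one> - frag_of g) ` carrier G)"
    by (intro int_span_uminus int_span.base) auto
  then show ?case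
    by (simp add: augmentation_def)
next
  case (diff c d)
  from int_span.diff[OF this] show ?case
    by (simp add: augmentation_diff frag_cmul_diff_distrib algebra_simps)
qed

lemma augmentation_ideal_int_span:
  assumes "c \<in> augmentation_ideal G"
  shows "c \<in> int_span ((\<lambda>g. frag_of \<one> - frag_of g) ` carrier G)"
  using diff_augmentation_int_span[of c] assms
  by (simp add: augmentation_ideal_def int_group_ring_def)

lemma foldr_mult_closed: "set xs \<subseteq> carrier G \<Longrightarrow> foldr (\<otimes>) xs \<one> \<in> carrier G"
  by (induction xs) auto

lemma foldr_mult_snoc:
  "set xs \<subseteq> carrier G \<Longrightarrow> x \<in> carrier G \<Longrightarrow> foldr (\<otimes>) (xs @ [x]) \<one> = foldr (\<otimes>) xs \<one> \<otimes> x"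
  by (induction xs) (auto simp: m_assoc foldr_mult_closed simp del: foldr_append)

lemma ordered_prod_closed:
  assumes "finite I" "\<alpha> \<in> I \<rightarrow> carrier G"
  shows "ordered_prod G \<alpha> I \<in> carrier G"
  using assms by (auto simp: ordered_prod_def intro!: foldr_mult_closed)

lemma ordered_prod_insert:
  assumes "I \<subseteq> {..<k}" "\<alpha> \<in> I \<rightarrow> carrier G" "g \<in> carrier G"
  shows "ordered_prod G (\<alpha>(k := g)) (insert k I) = ordered_prod G \<alpha> I \<otimes> g"
proof -
  have fin: "finite I"
    using assms(1) finite_subset by blast
  have "sorted_list_of_set (insert k I) = sorted_list_of_set I @ [k]"
  proof -
    have "k \<notin> I" "sorted (sorted_list_of_set I @ [k])"
      using fin assms(1) by (auto simp: sorted_append less_imp_le)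
    then show ?thesis
      using sorted_list_of_set.idem_if_sorted_distinct[of "sorted_list_of_set I @ [k]"] fin
      by simp
  qed
  moreover have "map (\<alpha>(k := g)) (sorted_list_of_set I) = map \<alpha> (sorted_list_of_set I)"
    using fin assms(1) by auto
  moreover have "set (map \<alpha> (sorted_list_of_set I)) \<subseteq> carrier G"
    using fin assms(2) by auto
  ultimately show ?thesis
    using foldr_mult_snoc[OF _ assms(3)] by (simp add: ordered_prod_def del: map_eq_conv)
qed

lemma ordered_prod_fun_upd:
  assumes "I \<subseteq> {..<k}"
  shows "ordered_prod G (\<alpha>(k := g)) I = ordered_prod G \<alpha> I"
proof -
  have "finite I"
    using assms finite_subset by blast
  then have "map (\<alpha>(k := g)) (sorted_list_of_set I) = map \<alpha> (sorted_list_of_set I)"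
    using assms by auto
  then show ?thesis
    unfolding ordered_prod_def by (rule arg_cong)
qed

text \<open>The product \<open>\<beta>(1 - \<alpha>\<^sub>0)\<cdots>(1 - \<alpha>\<^bsub>k-1\<^esub>)\<close> in the group ring, expanded.\<close>

definition alternating_product :: "nat \<Rightarrow> 'a \<Rightarrow> (nat \<Rightarrow> 'a) \<Rightarrow> 'a \<Rightarrow>\<^sub>0 int" where
  "alternating_product k \<beta> \<alpha> =
     (\<Sum>I\<in>Pow {..<k}. frag_cmul ((-1) ^ card I) (frag_of (\<beta> \<otimes> ordered_prod G \<alpha> I)))"

text \<open>Subsets of \<open>{..<Suc k}\<close> that avoid \<open>k\<close> give the contribution
  of \<open>1\<close>. In the others \<open>k\<close> is the largest index, so its factor
  \<open>g\<close> stands last and the larger cardinality supplies the minus sign of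
  \<open>- g\<close>.\<close>

lemma alternating_product_Suc:
  assumes "\<beta> \<in> carrier G" "\<alpha> \<in> {..<k} \<rightarrow> carrier G" "g \<in> carrier G"
  shows "frag_bilinear (\<otimes>) (alternating_product k \<beta> \<alpha>) (frag_of \<one> - frag_of g)
       = alternating_product (Suc k) \<beta> (\<alpha>(k := g))"
proof -
  let ?u = "\<lambda>I. frag_cmul ((-1) ^ card I) (frag_of (\<beta> \<otimes> ordered_prod G (\<alpha>(k := g)) I))"
  have closed: "ordered_prod G \<alpha> I \<in> carrier G" if "I \<in> Pow {..<k}" for I
    using that assms(2) by (intro ordered_prod_closed) (auto intro: finite_subset)
  have inj: "inj_on (insert k) (Pow {..<k})"
    by (auto simp: inj_on_def)
  have ins: "?u (insert k I) = - frag_cmul ((-1) ^ card I) (frag_of (\<beta> \<otimes> ordered_prod G \<alpha> I \<otimes> g))"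
    if "I \<in> Pow {..<k}" for I
  proof -
    have "finite I" "k \<notin> I"
      using that by (auto intro: finite_subset)
    moreover have "\<alpha> \<in> I \<rightarrow> carrier G"
      using that assms(2) by auto
    ultimately show ?thesis
      using that assms closed[OF that] by (simp add: ordered_prod_insert m_assoc)
  qed
  have "alternating_product (Suc k) \<beta> (\<alpha>(k := g)) = sum ?u (Pow {..<k}) + sum ?u (insert k ` Pow {..<k})"
    unfolding alternating_product_def lessThan_Suc Pow_insert
    by (rule sum.union_disjoint) auto
  also have "sum ?u (Pow {..<k}) = frag_bilinear (\<otimes>) (alternating_product k \<beta> \<alpha>) (frag_of \<one>)"
    unfolding alternating_product_def frag_bilinear_sum_frag_of[OF finite_Pow_iff[THEN iffD2, OF finite_lessThan]]
    using assms(1) closed by (intro sum.cong) (auto simp: ordered_prod_fun_upd)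
  also have "sum ?u (insert k ` Pow {..<k})
      = (\<Sum>I\<in>Pow {..<k}. - frag_cmul ((-1) ^ card I) (frag_of (\<beta> \<otimes> ordered_prod G \<alpha> I \<otimes> g)))"
    unfolding sum.reindex[OF inj] comp_def by (rule sum.cong[OF refl]) (rule ins)
  also have "\<dots> = - frag_bilinear (\<otimes>) (alternating_product k \<beta> \<alpha>) (frag_of g)"
    unfolding alternating_product_def frag_bilinear_sum_frag_of[OF finite_Pow_iff[THEN iffD2, OF finite_lessThan]]
    by (rule sum_negf)
  finally show ?thesis
    by (simp only: frag_bilinear_simps(4)) (simp only: diff_conv_add_uminus)
qed

text \<open>The leading \<beta> stems from the zeroth power, which is the whole ring and spanned by
  group elements. Each further power multiplies on the right by elements of the augmentation ideal,
  that is, by combinations of elements \<open>1 - g\<close>.\<close>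

lemma ideal_power_int_span:
  assumes "u \<in> ideal_power (int_group_ring G) (augmentation_ideal G) k"
  shows "u \<in> int_span {alternating_product k \<beta> \<alpha> | \<beta> \<alpha>. \<beta> \<in> carrier G \<and> \<alpha> \<in> {..<k} \<rightarrow> carrier G}"
  using assms
proof (induction k arbitrary: u)
  case 0
  then have "u \<in> int_span (frag_of ` carrier G)"
    by (intro int_span_frag_of) (simp add: int_group_ring_def)
  moreover have "frag_of ` carrier G = {alternating_product 0 \<beta> \<alpha> | \<beta> \<alpha>. \<beta> \<in> carrier G \<and> \<alpha> \<in> {..<0} \<rightarrow> carrier G}"
    by (force simp: alternating_product_def ordered_prod_def)
  ultimately show ?case
    by simp
next
  case (Suc k)
  have "u \<in> ideal_prod (int_group_ring G) (ideal_power (int_group_ring G) (augmentation_ideal G) k)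
          (augmentation_ideal G)"
    using Suc.prems by simp
  then show ?case
  proof induction
    case (prod x y)
    have "frag_bilinear (\<otimes>) s t \<in> int_span {alternating_product (Suc k) \<beta> \<alpha> | \<beta> \<alpha>. \<beta> \<in> carrier G \<and> \<alpha> \<in> {..<Suc k} \<rightarrow> carrier G}"
      if s: "s \<in> {alternating_product k \<beta> \<alpha> | \<beta> \<alpha>. \<beta> \<in> carrier G \<and> \<alpha> \<in> {..<k} \<rightarrow> carrier G}"
        and t: "t \<in> (\<lambda>g. frag_of \<one> - frag_of g) ` carrier G" for s t
    proof -
      obtain \<beta> \<alpha> g where *: "\<beta> \<in> carrier G" "\<alpha> \<in> {..<k} \<rightarrow> carrier G" "g \<in> carrier G"
        and st: "s = alternating_product k \<beta> \<alpha>" "t = frag_of \<one> - frag_of g"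
        using s t by blast
      have "\<alpha>(k := g) \<in> {..<Suc k} \<rightarrow> carrier G"
        using * by (auto simp: less_Suc_eq)
      then show ?thesis
        unfolding st alternating_product_Suc[OF *] using *(1) by (intro int_span.base) blast
    qed
    from frag_bilinear_int_span[OF Suc.IH[OF prod(1)] augmentation_ideal_int_span[OF prod(2)] this]
    show ?case
      by (simp add: int_group_ring_def)
  next
    case (sum x y)
    then show ?case
      by (simp add: int_group_ring_def int_span_add)
  qed
qed

end

section \<open>Relative homology classes\<close>

lemma comm_group_relative_homology_group [simp]: "comm_group (relative_homology_group (int p) X S)"
  unfolding nontrivial_relative_homology_group
  by (intro comm_group.abelian_FactGroup) (simp_all add: subgroup_singular_relboundary_relcycle)

lemma homologous_rel_set_mult:
  assumes "singular_relcycle p X S c" "singular_relcycle p X S d"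
  shows "homologous_rel_set p X S c \<otimes>\<^bsub>relative_homology_group (int p) X S\<^esub> homologous_rel_set p X S d
       = homologous_rel_set p X S (c + d)"
  using hom_mult[OF normal.r_coset_hom_Mod[OF normal_subgroup_singular_relboundary_relcycle[of p X S]], of c d] assms
  by (simp add: right_coset_singular_relboundary nontrivial_relative_homology_group)

lemma homologous_rel_set_closed:
  "singular_relcycle p X S c \<Longrightarrow> homologous_rel_set p X S c \<in> carrier (relative_homology_group (int p) X S)"
  by (simp add: carrier_relative_homology_group)

lemma homologous_rel_set_0: "homologous_rel_set p X S 0 = \<one>\<^bsub>relative_homology_group (int p) X S\<^esub>"
  by (simp add: homologous_rel_set_eq_relboundary)

lemma homologous_rel_set_int_pow:
  assumes "singular_relcycle p X S c"
  shows "homologous_rel_set p X S c [^]\<^bsub>relative_homology_group (int p) X S\<^esub> (k :: int)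
       = homologous_rel_set p X S (frag_cmul k c)"
proof -
  let ?H = "relative_homology_group (int p) X S"
  interpret H: comm_group ?H by simp
  have nat: "homologous_rel_set p X S c [^]\<^bsub>?H\<^esub> m = homologous_rel_set p X S (frag_cmul (int m) c)" for m :: nat
  proof (induction m)
    case 0
    then show ?case by (simp add: homologous_rel_set_0 del: one_relative_homology_group)
  next
    case (Suc m)
    have "frag_cmul (int (Suc m)) c = frag_cmul (int m) c + c"
      by (simp add: frag_cmul_distrib)
    then show ?case
      using Suc assms by (simp add: homologous_rel_set_mult singular_relcycle_cmul)
  qed
  show ?thesis
  proof (cases k)
    case (nonneg m)
    then show ?thesis
      by (simp add: int_pow_int nat)
  next
    case (neg m)
    \<comment> \<open>For a negative exponent the inverse is recognized from a product equal to the
      neutral element, which leaves only natural exponents.\<close>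
    have "homologous_rel_set p X S (frag_cmul k c) \<otimes>\<^bsub>?H\<^esub> homologous_rel_set p X S (frag_cmul (int (Suc m)) c) = \<one>\<^bsub>?H\<^esub>"
      using assms neg
      by (simp add: homologous_rel_set_mult singular_relcycle_cmul homologous_rel_set_0
          flip: frag_cmul_distrib del: one_relative_homology_group)
    then have "inv\<^bsub>?H\<^esub> (homologous_rel_set p X S (frag_cmul (int (Suc m)) c)) = homologous_rel_set p X S (frag_cmul k c)"
      using assms by (intro H.inv_equality homologous_rel_set_closed singular_relcycle_cmul)
    then show ?thesis
      using assms neg by (simp only: H.int_pow_neg_int nat homologous_rel_set_closed)
  qed
qed

text \<open>The homology group is written multiplicatively, the chain group additively. Through this
  translation an alternating product is trivial as soon as one explicit chain is a relative
  boundary.\<close>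

lemma finprod_homologous_rel_set:
  assumes "finite A" "\<And>x. x \<in> A \<Longrightarrow> singular_relcycle p X S (z x)"
  shows "finprod (relative_homology_group (int p) X S)
           (\<lambda>x. homologous_rel_set p X S (z x) [^]\<^bsub>relative_homology_group (int p) X S\<^esub> (k x :: int)) A
       = homologous_rel_set p X S (\<Sum>x\<in>A. frag_cmul (k x) (z x))"
proof -
  let ?H = "relative_homology_group (int p) X S"
  interpret H: comm_group ?H by simp
  show ?thesis
    using assms
  proof (induction A rule: finite_induct)
    case empty
    then show ?case
      by (simp add: homologous_rel_set_0 del: one_relative_homology_group)
  next
    case (insert x A)
    then show ?case
      by (simp add: homologous_rel_set_int_pow homologous_rel_set_closed homologous_rel_set_mult
          singular_relcycle_cmul singular_relcycle_sum)
  qed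
qed

section \<open>The map on homotopy classes of paths\<close>

lemma path_simplex_class_eqI:
  assumes "g \<in> Chem X a b" "path_homotopic X g g'"
  shows "path_simplex_class X a b n g = path_simplex_class X a b n g'"
  using homologous_rel_path_simplex[OF assms, of n]
  unfolding path_simplex_class_def by (simp add: homologous_rel_set_eq)

lemma path_simplex_class_closed:
  assumes "g \<in> Chem X a b"
  shows "path_simplex_class X a b n g \<in> carrier (HnXY X a b n)"
  unfolding path_simplex_class_def
  using assms by (intro homologous_rel_set_closed singular_relcycle_path_simplex)

definition pi1_rep :: "'a topology \<Rightarrow> 'a \<Rightarrow> 'a \<Rightarrow> (real \<Rightarrow> 'a) set \<Rightarrow> real \<Rightarrow> 'a" where
  "pi1_rep X a b C = (SOME g. g \<in> Chem X a b \<and> path_class X g = C)"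

lemma pi1_rep:
  assumes "C \<in> pi1 X a b"
  shows "pi1_rep X a b C \<in> Chem X a b" "path_class X (pi1_rep X a b C) = C"
proof -
  have "\<exists>g. g \<in> Chem X a b \<and> path_class X g = C"
    using assms by (auto simp: pi1_def)
  from someI_ex[OF this] show "pi1_rep X a b C \<in> Chem X a b" "path_class X (pi1_rep X a b C) = C"
    by (auto simp: pi1_rep_def)
qed

lemma ex1_represents_path_simplices: "\<exists>!F. represents_path_simplices X a b n F"
proof (rule ex_ex1I)
  define F where "F = (\<lambda>C\<in>pi1 X a b. path_simplex_class X a b n (pi1_rep X a b C))"
  have "F \<in> pi1 X a b \<rightarrow>\<^sub>E carrier (HnXY X a b n)"
    unfolding F_def using pi1_rep by (intro restrict_PiE_iff[THEN iffD2] ballI path_simplex_class_closed)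
  moreover have "path_simplex_class X a b n g = F (path_class X g)" if g: "g \<in> Chem X a b" for g
  proof -
    have C: "path_class X g \<in> pi1 X a b"
      using g by (simp add: pi1_def)
    have "path_homotopic X g (pi1_rep X a b (path_class X g))"
      using pi1_rep[OF C] path_class_eq_iff[of X "pi1_rep X a b (path_class X g)" g] by (simp add: Chem_def)
    with C g show ?thesis
      by (simp add: F_def path_simplex_class_eqI)
  qed
  ultimately show "\<exists>F. represents_path_simplices X a b n F"
    unfolding represents_path_simplices_def by blast
next
  fix F F' assume F: "represents_path_simplices X a b n F" and F': "represents_path_simplices X a b n F'"
  show "F = F'"
  \<comment> \<open>Every class has a representing path, which determines \<open>F\<close> on
    \<open>pi1 X a b\<close>; elsewhere both functions take the default value of an extensional
    function, so they agree everywhere.\<close>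
  proof (rule extensionalityI[of F "pi1 X a b" F'])
    show "F C = F' C" if "C \<in> pi1 X a b" for C
      using that F F' unfolding represents_path_simplices_def pi1_def by force
  qed (use F F' in \<open>auto simp: represents_path_simplices_def PiE_def\<close>)
qed

section \<open>The alternating relation\<close>

lemma loop_path_class:
  assumes "a \<in> topspace X" "\<And>k. k \<in> set ks \<Longrightarrow> g k \<in> Chem X a a"
  shows "path_class X (loop_path a g ks)
       = foldr (class_mult X) (map (\<lambda>k. path_class X (g k)) ks) (path_class X (\<lambda>_. a))"
  using assms(2)
proof (induction ks)
  case (Cons k ks)
  then have "loop_path a g ks \<in> Chem X a a" "g k \<in> Chem X a a"
    by (auto intro: loop_path_Chem assms(1))
  from class_mult_path_class[OF this] Cons show ?case
    by simp
qed simp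

text \<open>Arbitrary representatives \<open>z I\<close> are exchanged, one subset at a time, for
  the concatenations with fixed slots. Each exchange alters the chain by a relative boundary only,
  and for the concatenations the claim is already known.\<close>

lemma alternating_path_simplices_relboundary:
  assumes a: "a \<in> topspace X" and \<gamma>: "\<gamma> \<in> pi1 X a b" and \<alpha>: "\<alpha> \<in> {0..n} \<rightarrow> pi1 X a a"
    and z: "\<And>I. I \<subseteq> {0..n} \<Longrightarrow> z I \<in> Chem X a b"
      "\<And>I. I \<subseteq> {0..n} \<Longrightarrow> path_class X (z I) = class_mult X \<gamma> (ordered_prod (pi1_group X a) \<alpha> I)"
  shows "singular_relboundary n (power_space X n) (Yset X a b n)
    (\<Sum>I\<in>Pow {0..n}. frag_cmul ((-1) ^ card I) (frag_of (path_simplex n (z I))))"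
proof -
  let ?P = "power_space X n" and ?Y = "Yset X a b n"
  obtain c where c: "c \<in> Chem X a b" "path_class X c = \<gamma>"
    using \<gamma> by (auto simp: pi1_def)
  \<comment> \<open>The rest at \<open>a\<close> during the first half is demanded for all
    \<open>k\<close>, also beyond \<open>n\<close>, so that it can be passed on without a range
    condition.\<close>
  have "\<exists>g. (k \<in> {0..n} \<longrightarrow> g \<in> Chem X a a \<and> path_class X g = \<alpha> k) \<and> (\<forall>t\<le>1/2. g t = a)" for k
  proof (cases "k \<in> {0..n}")
    case True
    then have "\<alpha> k \<in> pi1 X a a"
      using \<alpha> by auto
    from pi1_representative_const_start[OF a this] show ?thesis
      by metis
  qed auto
  then obtain g where g: "\<And>k. k \<in> {0..n} \<Longrightarrow> g k \<in> Chem X a a" "\<And>k. k \<in> {0..n} \<Longrightarrow> path_class X (g k) = \<alpha> k"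
    "\<And>k t. t \<le> 1/2 \<Longrightarrow> g k t = a"
    by metis
  define q where "q = (\<lambda>I. loop_path a (\<lambda>k. if k \<in> I then g k else (\<lambda>_. a)) [0..<Suc n])"
  have hom: "homologous_rel n ?P ?Y (frag_of (path_simplex n (z I))) (frag_of (path_simplex n (then_path (q I) c)))"
    if I: "I \<subseteq> {0..n}" for I
  proof (rule homologous_rel_path_simplex[OF z(1)[OF I]])
    have fin: "finite I"
      using I finite_subset by blast
    \<comment> \<open>Deleting the empty slots leaves the increasing enumeration of
      \<open>I\<close>, the same list that \<open>ordered_prod\<close> multiplies.\<close>
    have list: "filter (\<lambda>k. k \<in> I) [0..<Suc n] = sorted_list_of_set I"
    proof -
      have "set (filter (\<lambda>k. k \<in> I) [0..<Suc n]) = I"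
        using I by (auto simp: subset_iff simp del: upt_Suc)
      moreover have "sorted (filter (\<lambda>k. k \<in> I) [0..<Suc n])"
        by (intro sorted_wrt_filter sorted_upt)
      ultimately show ?thesis
        using sorted_list_of_set.idem_if_sorted_distinct[of "filter (\<lambda>k. k \<in> I) [0..<Suc n]"] by simp
    qed
    have q: "q I \<in> Chem X a a"
      unfolding q_def by (rule loop_path_Chem[OF a]) (use g(1) const_path_Chem[OF a] in auto)
    have "path_class X (q I) = path_class X (loop_path a g (sorted_list_of_set I))"
      unfolding q_def list[symmetric] by (rule path_class_eqI, rule loop_path_filter[OF a]) (use g(1) in auto)
    also have "\<dots> = foldr (class_mult X) (map (\<lambda>k. path_class X (g k)) (sorted_list_of_set I)) (path_class X (\<lambda>_. a))"
      by (rule loop_path_class[OF a]) (use g(1) I fin in auto)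
    also have "map (\<lambda>k. path_class X (g k)) (sorted_list_of_set I) = map \<alpha> (sorted_list_of_set I)"
      using g(2) I fin by auto
    finally have "path_class X (q I) = ordered_prod (pi1_group X a) \<alpha> I"
      by (simp add: ordered_prod_def)
    then have "path_class X (z I) = path_class X (then_path (q I) c)"
      using z(2)[OF I] class_mult_path_class[OF q c(1)] c(2) by simp
    moreover have "pathin X (then_path (q I) c)"
      using then_path_Chem[OF q c(1)] by (simp add: Chem_def)
    ultimately show "path_homotopic X (z I) (then_path (q I) c)"
      by (simp add: path_class_eq_iff)
  qed
  let ?s = "\<lambda>p. \<Sum>I\<in>Pow {0..n}. frag_cmul ((-1) ^ card I) (frag_of (path_simplex n (p I)))"
  have "singular_relboundary n ?P ?Y (\<Sum>I\<in>Pow {0..n}. frag_cmul ((-1) ^ card I)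
      (frag_of (path_simplex n (z I)) - frag_of (path_simplex n (then_path (q I) c))))"
    using hom unfolding homologous_rel_def
    by (intro singular_relboundary_sum singular_relboundary_cmul) auto
  then have "singular_relboundary n ?P ?Y (?s z - ?s (\<lambda>I. then_path (q I) c))"
    by (simp add: frag_cmul_diff sum_subtractf)
  moreover have "singular_relboundary n ?P ?Y (?s (\<lambda>I. then_path (q I) c))"
    unfolding q_def by (rule alternating_loop_paths_relboundary[OF a c(1) g(1,3)])
  ultimately show ?thesis
    using singular_relboundary_add by fastforce
qed

text \<open>Choosing a representative of each product turns the values of \<open>F\<close> into
  classes of explicit simplices; the signs become integer exponents.\<close>

lemma alternating_finprod_path_simplices:
  assumes a: "a \<in> topspace X" and F: "represents_path_simplices X a b n F"
    and \<gamma>: "\<gamma> \<in> pi1 X a b" and \<alpha>: "\<alpha> \<in> {0..n} \<rightarrow> pi1 X a a"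
  shows "finprod (HnXY X a b n)
           (\<lambda>I. F (class_mult X \<gamma> (ordered_prod (pi1_group X a) \<alpha> I))
                  [^]\<^bsub>HnXY X a b n\<^esub> ((-1) ^ card I :: int))
           (Pow {0..n}) = \<one>\<^bsub>HnXY X a b n\<^esub>"
proof -
  interpret H: comm_group "HnXY X a b n" by simp
  interpret monoid "pi1_group X a" by (rule monoid_pi1_group[OF a])
  define z where "z = (\<lambda>I. pi1_rep X a b (class_mult X \<gamma> (ordered_prod (pi1_group X a) \<alpha> I)))"
  have "class_mult X \<gamma> (ordered_prod (pi1_group X a) \<alpha> I) \<in> pi1 X a b" if "I \<subseteq> {0..n}" for I
  proof -
    have "ordered_prod (pi1_group X a) \<alpha> I \<in> carrier (pi1_group X a)"
      using \<alpha> that by (intro ordered_prod_closed) (auto intro: finite_subset)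
    then show ?thesis
      using class_mult_closed[OF \<gamma>] by simp
  qed
  then have z: "z I \<in> Chem X a b" "path_class X (z I) = class_mult X \<gamma> (ordered_prod (pi1_group X a) \<alpha> I)"
    if "I \<subseteq> {0..n}" for I
    using that pi1_rep[of _ X a b] unfolding z_def by auto
  have F_eq: "F (class_mult X \<gamma> (ordered_prod (pi1_group X a) \<alpha> I))
      = homologous_rel_set n (power_space X n) (Yset X a b n) (frag_of (path_simplex n (z I)))"
    if "I \<subseteq> {0..n}" for I
    using F z[OF that] unfolding represents_path_simplices_def path_simplex_class_def by metis
  have cyc: "singular_relcycle n (power_space X n) (Yset X a b n) (frag_of (path_simplex n (z I)))"
    if "I \<subseteq> {0..n}" for I
    by (rule singular_relcycle_path_simplex[OF z(1)[OF that]])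
  have pow_closed: "homologous_rel_set n (power_space X n) (Yset X a b n) (frag_of (path_simplex n (z I)))
      [^]\<^bsub>HnXY X a b n\<^esub> ((-1) ^ card I :: int) \<in> carrier (HnXY X a b n)"
    if "I \<subseteq> {0..n}" for I
    by (intro H.int_pow_closed homologous_rel_set_closed cyc that)
  have "finprod (HnXY X a b n)
           (\<lambda>I. F (class_mult X \<gamma> (ordered_prod (pi1_group X a) \<alpha> I))
                  [^]\<^bsub>HnXY X a b n\<^esub> ((-1) ^ card I :: int)) (Pow {0..n})
      = finprod (HnXY X a b n)
           (\<lambda>I. homologous_rel_set n (power_space X n) (Yset X a b n) (frag_of (path_simplex n (z I)))
                  [^]\<^bsub>HnXY X a b n\<^esub> ((-1) ^ card I :: int)) (Pow {0..n})"
    by (rule H.finprod_cong') (use pow_closed in \<open>auto simp: F_eq simp del: One_nat_def\<close>)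
  also have "\<dots> = homologous_rel_set n (power_space X n) (Yset X a b n)
      (\<Sum>I\<in>Pow {0..n}. frag_cmul ((-1) ^ card I) (frag_of (path_simplex n (z I))))"
    by (rule finprod_homologous_rel_set) (use cyc in auto)
  also have "\<dots> = \<one>\<^bsub>HnXY X a b n\<^esub>"
    unfolding one_relative_homology_group homologous_rel_set_eq_relboundary
    by (rule alternating_path_simplices_relboundary[OF a \<gamma> \<alpha> z])
  finally show ?thesis .
qed

section \<open>Linear extension and descent to the quotient\<close>

lemma int_linear_extension_hom:
  assumes "comm_group H" "F \<in> S \<rightarrow> carrier H"
  shows "int_linear_extension H F \<in> hom (free_Abelian_group S) H"
proof -
  interpret H: comm_group H by (rule assms)
  \<comment> \<open>Keys can cancel in \<open>c + d\<close>, so additivity is compared over the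
    common index set of all keys of \<open>c\<close> and \<open>d\<close>; the extra factors have
    exponent 0.\<close>
  have ext: "int_linear_extension H F c = finprod H (\<lambda>x. F x [^]\<^bsub>H\<^esub> Poly_Mapping.lookup c x) A"
    if "finite A" "Poly_Mapping.keys c \<subseteq> A" "A \<subseteq> S" for A c
    unfolding int_linear_extension_def using that assms(2)
    by (intro H.finprod_mono_neutral_cong_left) (auto simp: in_keys_iff)
  show ?thesis
  proof (rule homI)
    show "int_linear_extension H F c \<in> carrier H" if "c \<in> carrier (free_Abelian_group S)" for c
      unfolding int_linear_extension_def using that assms(2) by (intro H.finprod_closed) auto
    fix c d assume "c \<in> carrier (free_Abelian_group S)" "d \<in> carrier (free_Abelian_group S)"
    then have S: "Poly_Mapping.keys c \<union> Poly_Mapping.keys d \<subseteq> S" (is "?A \<subseteq> S")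
      by simp
    have F_closed: "F x \<in> carrier H" if "x \<in> ?A" for x
      using that S assms(2) by auto
    have "int_linear_extension H F (c + d)
        = finprod H (\<lambda>x. F x [^]\<^bsub>H\<^esub> (Poly_Mapping.lookup c x + Poly_Mapping.lookup d x)) ?A"
      using keys_add[of c d] S by (subst ext[of ?A]) (auto simp: lookup_add)
    also have "\<dots> = finprod H (\<lambda>x. F x [^]\<^bsub>H\<^esub> Poly_Mapping.lookup c x \<otimes>\<^bsub>H\<^esub> F x [^]\<^bsub>H\<^esub> Poly_Mapping.lookup d x) ?A"
      using F_closed by (intro H.finprod_cong') (auto simp: H.int_pow_mult)
    also have "\<dots> = int_linear_extension H F c \<otimes>\<^bsub>H\<^esub> int_linear_extension H F d"
      using S F_closed by (subst H.finprod_multf) (auto simp: ext[of ?A])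
    finally show "int_linear_extension H F (c \<otimes>\<^bsub>free_Abelian_group S\<^esub> d)
        = int_linear_extension H F c \<otimes>\<^bsub>H\<^esub> int_linear_extension H F d"
      by simp
  qed
qed

text \<open>Different indices may have the same \<open>x i\<close>, as different \<open>I\<close>
  may give the same class, so coefficients can merge or cancel in the sum. Induction with the
  homomorphism property avoids computing its keys.\<close>

lemma int_linear_extension_sum:
  assumes "comm_group H" "F \<in> S \<rightarrow> carrier H" "finite A" "\<And>i. i \<in> A \<Longrightarrow> x i \<in> S"
  shows "int_linear_extension H F (\<Sum>i\<in>A. frag_cmul (k i) (frag_of (x i)))
       = finprod H (\<lambda>i. F (x i) [^]\<^bsub>H\<^esub> (k i :: int)) A"
proof -
  interpret H: comm_group H by (rule assms)
  let ?L = "int_linear_extension H F"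
  have F_closed: "F (x i) \<in> carrier H" if "i \<in> A" for i
    using assms(2,4) that by auto
  have cmul: "?L (frag_cmul (k i) (frag_of (x i))) = F (x i) [^]\<^bsub>H\<^esub> k i" if "i \<in> A" for i
  proof (cases "k i = 0")
    case False
    then have "Poly_Mapping.keys (frag_cmul (k i) (frag_of (x i))) = {x i}"
      by auto
    then show ?thesis
      using F_closed[OF that] by (simp add: int_linear_extension_def)
  qed (simp add: int_linear_extension_def)
  have keys: "Poly_Mapping.keys (\<Sum>i\<in>B. frag_cmul (k i) (frag_of (x i))) \<subseteq> S" if "B \<subseteq> A" for B
    using that assms(4) by (intro order_trans[OF keys_sum]) auto
  show ?thesis
    using assms(3) order_refl[of A]
  proof (induction A rule: finite_subset_induct')
    case empty
    then show ?case
      by (simp add: int_linear_extension_def)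
  next
    case (insert i B)
    have "frag_cmul (k i) (frag_of (x i)) \<in> carrier (free_Abelian_group S)"
      using insert assms(4) by auto
    moreover have "(\<Sum>i\<in>B. frag_cmul (k i) (frag_of (x i))) \<in> carrier (free_Abelian_group S)"
      using insert keys by auto
    ultimately have "?L (frag_cmul (k i) (frag_of (x i)) + (\<Sum>i\<in>B. frag_cmul (k i) (frag_of (x i))))
        = ?L (frag_cmul (k i) (frag_of (x i))) \<otimes>\<^bsub>H\<^esub> ?L (\<Sum>i\<in>B. frag_cmul (k i) (frag_of (x i)))"
      using hom_mult[OF int_linear_extension_hom[OF assms(1,2)]] by simp
    moreover have "(\<lambda>i. F (x i) [^]\<^bsub>H\<^esub> k i) \<in> B \<rightarrow> carrier H"
      using insert F_closed by auto
    ultimately show ?case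
      using insert F_closed by (simp add: cmul)
  qed
qed

text \<open>By associativity the leading loop class \<beta> of a spanning element is absorbed into
  the path class, as \<open>class_mult X \<gamma> \<beta>\<close> is again in
  \<open>pi1 X a b\<close>. What remains is an expression of the shape occurring in (b).\<close>

lemma frag_bilinear_class_mult_int_span:
  assumes a: "a \<in> topspace X" and c: "c \<in> carrier (Zpi1 X a b)"
    and u: "u \<in> ideal_power (int_group_ring (pi1_group X a)) (augmentation_ideal (pi1_group X a)) k"
  shows "frag_bilinear (class_mult X) c u \<in> int_span
    {\<Sum>I\<in>Pow {..<k}. frag_cmul ((-1) ^ card I) (frag_of (class_mult X \<gamma> (ordered_prod (pi1_group X a) \<alpha> I))) | \<gamma> \<alpha>.
       \<gamma> \<in> pi1 X a b \<and> \<alpha> \<in> {..<k} \<rightarrow> pi1 X a a}"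
proof -
  interpret monoid "pi1_group X a" by (rule monoid_pi1_group[OF a])
  have c': "c \<in> int_span (frag_of ` pi1 X a b)"
    using c by (intro int_span_frag_of) simp
  show ?thesis
  proof (rule frag_bilinear_int_span[OF c' ideal_power_int_span[OF u]])
    fix s t
    assume "s \<in> frag_of ` pi1 X a b"
      and "t \<in> {alternating_product k \<beta> \<alpha> | \<beta> \<alpha>. \<beta> \<in> carrier (pi1_group X a) \<and> \<alpha> \<in> {..<k} \<rightarrow> carrier (pi1_group X a)}"
    then obtain \<gamma> \<beta> \<alpha> where \<gamma>: "\<gamma> \<in> pi1 X a b" "s = frag_of \<gamma>"
      and t: "\<beta> \<in> pi1 X a a" "\<alpha> \<in> {..<k} \<rightarrow> pi1 X a a" "t = alternating_product k \<beta> \<alpha>"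
      by auto
    have "ordered_prod (pi1_group X a) \<alpha> I \<in> pi1 X a a" if "I \<in> Pow {..<k}" for I
    proof -
      have "finite I" "\<alpha> \<in> I \<rightarrow> carrier (pi1_group X a)"
        using that t(2) by (auto intro: finite_subset)
      from ordered_prod_closed[OF this] show ?thesis
        by simp
    qed
    then have "frag_bilinear (class_mult X) s t = (\<Sum>I\<in>Pow {..<k}. frag_cmul ((-1) ^ card I)
        (frag_of (class_mult X (class_mult X \<gamma> \<beta>) (ordered_prod (pi1_group X a) \<alpha> I))))"
      unfolding \<gamma>(2) t(3) alternating_product_def
      by (subst frag_bilinear_frag_of_sum)
        (auto simp: class_mult_assoc[where a = a, OF \<gamma>(1) t(1)] intro!: sum.cong)
    moreover have "class_mult X \<gamma> \<beta> \<in> pi1 X a b"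
      using \<gamma>(1) t(1) by (rule class_mult_closed)
    ultimately show "frag_bilinear (class_mult X) s t \<in> int_span
      {\<Sum>I\<in>Pow {..<k}. frag_cmul ((-1) ^ card I) (frag_of (class_mult X \<gamma> (ordered_prod (pi1_group X a) \<alpha> I))) | \<gamma> \<alpha>.
         \<gamma> \<in> pi1 X a b \<and> \<alpha> \<in> {..<k} \<rightarrow> pi1 X a a}"
      using t(2) by (intro int_span.base) blast
  qed
qed

lemma int_span_subset_subgroup:
  assumes N: "subgroup N (free_Abelian_group A)" and S: "S \<subseteq> N"
  shows "int_span S \<subseteq> N"
proof
  fix x assume "x \<in> int_span S"
  then show "x \<in> N"
  proof induction
    case zero
    then show ?case
      using subgroup.one_closed[OF N] by simp
  next
    case (diff x y)
    have "Poly_Mapping.keys y \<subseteq> A"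
      using subsetD[OF subgroup.subset[OF N] diff.IH(2)] by simp
    then show ?case
      using subgroup.m_closed[OF N diff.IH(1) subgroup.m_inv_closed[OF N diff.IH(2)]] by simp
  qed (use S in auto)
qed

text \<open>The kernel of the linear extension is a subgroup, so it is enough that it contains the
  spanning sums; those with \<open>n + 1\<close> loops are sent to the neutral element by
  (b).\<close>

lemma Zpi1_aug_submodule_kernel:
  assumes a: "a \<in> topspace X" and F: "represents_path_simplices X a b n F"
  shows "subgroup (Zpi1_aug_submodule X a b (n + 1)) (Zpi1 X a b)"
    and "Zpi1_aug_submodule X a b (n + 1)
       \<subseteq> kernel (Zpi1 X a b) (HnXY X a b n) (int_linear_extension (HnXY X a b n) F)"
proof -
  let ?H = "HnXY X a b n" and ?L = "int_linear_extension (HnXY X a b n) F"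
  interpret monoid "pi1_group X a" by (rule monoid_pi1_group[OF a])
  have F_closed: "F \<in> pi1 X a b \<rightarrow> carrier ?H"
    using F by (auto simp: represents_path_simplices_def)
  have L: "?L \<in> hom (Zpi1 X a b) ?H"
    by (rule int_linear_extension_hom[OF comm_group_relative_homology_group F_closed])
  interpret L: group_hom "Zpi1 X a b" ?H ?L
    by (rule group_hom.intro[OF group_free_Abelian_group group_relative_homology_group
          group_hom_axioms.intro[OF L]])
  have base: "(\<Sum>I\<in>Pow {..<n + 1}. frag_cmul ((-1) ^ card I) (frag_of (class_mult X \<gamma> (ordered_prod (pi1_group X a) \<alpha> I))))
      \<in> kernel (Zpi1 X a b) ?H ?L"
    if \<gamma>: "\<gamma> \<in> pi1 X a b" and \<alpha>: "\<alpha> \<in> {..<n + 1} \<rightarrow> pi1 X a a" for \<gamma> \<alpha>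
  proof -
    have eq: "{..<n + 1} = {0..n}"
      by auto
    have closed: "class_mult X \<gamma> (ordered_prod (pi1_group X a) \<alpha> I) \<in> pi1 X a b" if "I \<in> Pow {0..n}" for I
    proof -
      have "finite I" "\<alpha> \<in> I \<rightarrow> carrier (pi1_group X a)"
        using that \<alpha> unfolding eq by (auto intro: finite_subset)
      from class_mult_closed[OF \<gamma>] ordered_prod_closed[OF this] show ?thesis
        by simp
    qed
    let ?s = "\<Sum>I\<in>Pow {0..n}. frag_cmul ((-1) ^ card I) (frag_of (class_mult X \<gamma> (ordered_prod (pi1_group X a) \<alpha> I)))"
    have "?L ?s = finprod ?H (\<lambda>I. F (class_mult X \<gamma> (ordered_prod (pi1_group X a) \<alpha> I))
        [^]\<^bsub>?H\<^esub> ((-1) ^ card I :: int)) (Pow {0..n})"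
      by (rule int_linear_extension_sum[OF comm_group_relative_homology_group F_closed _ closed]) auto
    also have "\<dots> = \<one>\<^bsub>?H\<^esub>"
      by (rule alternating_finprod_path_simplices[OF a F \<gamma> \<alpha>[unfolded eq]])
    finally have "?L ?s = \<one>\<^bsub>?H\<^esub>" .
    moreover have "Poly_Mapping.keys ?s \<subseteq> pi1 X a b"
      using closed by (intro order_trans[OF keys_sum]) auto
    ultimately show ?thesis
      unfolding eq by (simp add: kernel_def)
  qed
  have "int_span
    {\<Sum>I\<in>Pow {..<n + 1}. frag_cmul ((-1) ^ card I) (frag_of (class_mult X \<gamma> (ordered_prod (pi1_group X a) \<alpha> I))) | \<gamma> \<alpha>.
       \<gamma> \<in> pi1 X a b \<and> \<alpha> \<in> {..<n + 1} \<rightarrow> pi1 X a a} \<subseteq> kernel (Zpi1 X a b) ?H ?L"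
    using base by (intro int_span_subset_subgroup[OF L.subgroup_kernel]) blast
  then have gens: "{frag_bilinear (class_mult X) c u | c u. c \<in> carrier (Zpi1 X a b) \<and>
      u \<in> ideal_power (int_group_ring (pi1_group X a)) (augmentation_ideal (pi1_group X a)) (n + 1)}
      \<subseteq> kernel (Zpi1 X a b) ?H ?L"
    using frag_bilinear_class_mult_int_span[OF a, of _ b _ "n + 1"] by blast
  show "Zpi1_aug_submodule X a b (n + 1) \<subseteq> kernel (Zpi1 X a b) ?H ?L"
    unfolding Zpi1_aug_submodule_def
    by (rule group.generate_subgroup_incl[OF group_free_Abelian_group gens L.subgroup_kernel])
  \<comment> \<open>The kernel lies in the carrier, so \<open>gens\<close> also shows that the
    generators belong to the group.\<close>
  show "subgroup (Zpi1_aug_submodule X a b (n + 1)) (Zpi1 X a b)"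
    unfolding Zpi1_aug_submodule_def
    by (rule group.generate_is_subgroup[OF group_free_Abelian_group order_trans[OF gens subgroup.subset[OF L.subgroup_kernel]]])
qed

text \<open>In an abelian group the submodule is normal, and a homomorphism whose kernel contains it
  descends to the cosets.\<close>

lemma int_linear_extension_factors:
  assumes a: "a \<in> topspace X" and F: "represents_path_simplices X a b n F"
  shows "\<exists>Fbar\<in>hom (Zpi1 X a b Mod Zpi1_aug_submodule X a b (n + 1)) (HnXY X a b n).
           \<forall>c\<in>carrier (Zpi1 X a b).
             Fbar (Zpi1_aug_submodule X a b (n + 1) #>\<^bsub>Zpi1 X a b\<^esub> c)
               = int_linear_extension (HnXY X a b n) F c"
proof -
  let ?H = "HnXY X a b n" and ?L = "int_linear_extension (HnXY X a b n) F"
  have "F \<in> pi1 X a b \<rightarrow> carrier ?H"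
    using F by (auto simp: represents_path_simplices_def)
  then have L: "?L \<in> hom (Zpi1 X a b) ?H"
    by (rule int_linear_extension_hom[OF comm_group_relative_homology_group])
  interpret L: group_hom "Zpi1 X a b" ?H ?L
    by (rule group_hom.intro[OF group_free_Abelian_group group_relative_homology_group
          group_hom_axioms.intro[OF L]])
  have "Zpi1_aug_submodule X a b (n + 1) \<lhd> Zpi1 X a b"
    using Zpi1_aug_submodule_kernel(1)[OF a F]
    by (simp only: comm_group.normal_iff_subgroup[OF abelian_free_Abelian_group])
  from L.FactGroup_universal_kernel[OF this Zpi1_aug_submodule_kernel(2)[OF a F]] show ?thesis
    by metis
qed

theorem mainTheorem1:fixes X :: "'a topology" and a b :: 'a and n :: nat
  assumes "a \<in> topspace X" and "b \<in> topspace X" and "n \<ge> 1"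
  shows "(\<exists>!F. represents_path_simplices X a b n F) \<and>
    (\<forall>F. represents_path_simplices X a b n F \<longrightarrow>
      (\<forall>\<gamma>\<in>pi1 X a b. \<forall>\<alpha>\<in>{0..n} \<rightarrow> pi1 X a a.
         finprod (HnXY X a b n)
           (\<lambda>I. F (class_mult X \<gamma> (ordered_prod (pi1_group X a) \<alpha> I))
                  [^]\<^bsub>HnXY X a b n\<^esub> ((-1) ^ card I :: int))
           (Pow {0..n}) = \<one>\<^bsub>HnXY X a b n\<^esub>) \<and>
      (\<exists>Fbar\<in>hom (Zpi1 X a b Mod Zpi1_aug_submodule X a b (n + 1)) (HnXY X a b n).
         \<forall>c\<in>carrier (Zpi1 X a b).
           Fbar (Zpi1_aug_submodule X a b (n + 1) #>\<^bsub>Zpi1 X a b\<^esub> c)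
             = int_linear_extension (HnXY X a b n) F c))"
  by (intro conjI allI impI ballI ex1_represents_path_simplices int_linear_extension_factors
      alternating_finprod_path_simplices assms)

end
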